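(* Let $(V_\bullet,\omega)$ be a conformal vertex algebra such that $\ker(T)\cap V_i^\omega=\{0\}$ for all $i<0$. (1) One has $T(P_0)\subseteq P_1$, the natural map $\check P_0:=P_1/T(P_0)\to\check V_0^\omega:=V_1^\omega/T(V_0^\omega)$ is injective, and it makes $\check P_0$ a Lie subalgebra of $\check V_0^\omega$. (2) The linear map $[-,-]:\check V_i\times V_j\to V_{i+j}$, $(\bar a,b)\mapsto a_{(0)}b$, restricts for every $i\in\mathbb Z$ to a map $$[-,-]:\check P_0\times P_i\to P_i,$$ which makes $P_i$ a subrepresentation of $V_i^\omega$ with respect to the Lie algebra $\check P_0$.
   Context: Vertex algebra means $\mathbb Z$-graded vertex superalgebra over $\mathbb C$ (parity is degree mod 2): a graded vector space $V_\bullet$ with vacuum $|0\rangle\in V_0$, translation operator $T:V_\bullet\to V_{\bullet+2}$ and state-field correspondence $Y(a,z)=\sum_{n\in\mathbb Z}a_{(n)}z^{-n-1}$, with $a_{(n)}:V_\bullet\to V_{\bullet+\deg a-2n-2}$, satisfying the usual vacuum, translation covariance and locality axioms. A conformal element is $\omega\in V_4$ whose modes $L_n=\omega_{(n+1)}$ satisfy $[L_n,L_m]=(n-m)L_{n+m}+\frac{n^3-n}{12}\delta_{n+m,0}\,C$ for a constant $C\in\mathbb C$, $L_{-1}=T$, and $L_0$ is diagonalizable; $(V_\bullet,\omega)$ is then called a conformal vertex algebra. $V_i^\omega$ is the $i$-eigenspace of $L_0$. The primary states of conformal weight $i$ are $P_i=\{a\in V_i^\omega: L_n(a)=0\text{ for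 all }n\ge1\}$. Borcherds' Lie algebra is $\check V_\bullet=V_{\bullet+2}/T(V_\bullet)$ with $[\bar a,\bar b]=\overline{a_{(0)}b}$; $\check V_0^\omega=V_1^\omega/T(V_0^\omega)$ is a Lie subalgebra of $V_\bullet/T(V_\bullet)$. The map $(\bar a,b)\mapsto a_{(0)}b$ is well defined and makes $V_\bullet$ a representation of $\check V_\bullet$. (In the paper, Virasoro constraints for sheaf and pair classes are membership in $\check P_0$ and $P_0$ respectively, and wall-crossing formulae are written with these brackets.) *)

theory Defs
  imports Complex_Main "HOL-Algebra.Algebraic_Closure_Type"
begin

section \<open>Conformal vertex superalgebras\<close>

text \<open>
  The underlying ungraded vector space of the vertex algebra is the whole type \<open>'v\<close>;
  \<open>piece \<V> i\<close> is the homogeneous piece \<open>V_i\<close>. The field \<open>Y(a,z) = \<Sum>n. a_(n) z^(-n-1)\<close> is given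
  by its modes: \<open>nmode \<V> a n b\<close> is \<open>a_(n) b\<close>.
\<close>

record 'v vertex_data =
  scalar :: "complex \<Rightarrow> 'v \<Rightarrow> 'v"
  piece :: "int \<Rightarrow> 'v set"
  vacuum :: 'v
  transl :: "'v \<Rightarrow> 'v"
  nmode :: "'v \<Rightarrow> int \<Rightarrow> 'v \<Rightarrow> 'v"

definition koszul_sign :: "int \<Rightarrow> int \<Rightarrow> complex" where
  "koszul_sign i j = (if odd i \<and> odd j then - 1 else 1)"

definition homogeneous_decomposition :: "(int \<Rightarrow> 'v::ab_group_add set) \<Rightarrow> (int \<Rightarrow> 'v) \<Rightarrow> 'v \<Rightarrow> bool" where
  "homogeneous_decomposition G f v \<longleftrightarrow>
     (\<forall>i. f i \<in> G i) \<and> finite {i. f i \<noteq> 0} \<and> v = (\<Sum>i | f i \<noteq> 0. f i)"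

text \<open>
  Locality, \<open>(z - w)^N [Y(a,z), Y(b,w)] = 0\<close> for some \<open>N\<close> and with the supercommutator,
  is stated coefficientwise: the equation below is the coefficient of \<open>z^(-m-1) w^(-n-1)\<close>.
\<close>

locale vertex_superalgebra = vector_space "scalar \<V>"
  for \<V> :: "'v::ab_group_add vertex_data" +
  assumes piece_subspace: "\<And>i. subspace (piece \<V> i)"
    and direct_sum: "\<And>v. \<exists>!f. homogeneous_decomposition (piece \<V>) f v"
    and vacuum_degree: "vacuum \<V> \<in> piece \<V> 0"
    and transl_linear: "Vector_Spaces.linear (scalar \<V>) (scalar \<V>) (transl \<V>)"
    and transl_degree: "\<And>i a. a \<in> piece \<V> i \<Longrightarrow> transl \<V> a \<in> piece \<V> (i + 2)"
    and mode_linear_left: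
      "\<And>n b. Vector_Spaces.linear (scalar \<V>) (scalar \<V>) (\<lambda>a. nmode \<V> a n b)"
    and mode_linear_right:
      "\<And>a n. Vector_Spaces.linear (scalar \<V>) (scalar \<V>) (nmode \<V> a n)"
    and mode_degree: "\<And>i j n a b. a \<in> piece \<V> i \<Longrightarrow> b \<in> piece \<V> j \<Longrightarrow>
      nmode \<V> a n b \<in> piece \<V> (j + i - 2 * n - 2)"
    and field: "\<And>a b. \<exists>N. \<forall>n\<ge>N. nmode \<V> a n b = 0"
    and vacuum_identity: "\<And>n a. nmode \<V> (vacuum \<V>) n a = (if n = - 1 then a else 0)"
    and creation: "\<And>a. nmode \<V> a (- 1) (vacuum \<V>) = a"
      "\<And>a n. n \<ge> 0 \<Longrightarrow> nmode \<V> a n (vacuum \<V>) = 0"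
    and transl_vacuum: "transl \<V> (vacuum \<V>) = 0"
    and translation_covariance:
      "\<And>a n b. transl \<V> (nmode \<V> a n b) - nmode \<V> a n (transl \<V> b)
         = scalar \<V> (- of_int n) (nmode \<V> a (n - 1) b)"
    and locality: "\<And>i j a b. a \<in> piece \<V> i \<Longrightarrow> b \<in> piece \<V> j \<Longrightarrow>
      \<exists>N::nat. \<forall>m n c.
        (\<Sum>k\<le>N. scalar \<V> ((- 1) ^ k * of_nat (N choose k))
           (nmode \<V> a (m + int (N - k)) (nmode \<V> b (n + int k) c)
            - scalar \<V> (koszul_sign i j)
                (nmode \<V> b (n + int k) (nmode \<V> a (m + int (N - k)) c)))) = 0"

definition vir :: "'v vertex_data \<Rightarrow> 'v \<Rightarrow> int \<Rightarrow> 'v \<Rightarrow> 'v" where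
  "vir \<V> \<omega> n = nmode \<V> \<omega> (n + 1)"

definition diagonalizable :: "(complex \<Rightarrow> 'v::ab_group_add \<Rightarrow> 'v) \<Rightarrow> ('v \<Rightarrow> 'v) \<Rightarrow> bool" where
  "diagonalizable s f \<longleftrightarrow>
     (\<exists>B. \<not> module.dependent s B \<and> module.span s B = UNIV \<and> (\<forall>b\<in>B. \<exists>c. f b = s c b))"

locale conformal_vertex_superalgebra = vertex_superalgebra \<V>
  for \<V> :: "'v::ab_group_add vertex_data" +
  fixes \<omega> :: 'v
  assumes conformal_degree: "\<omega> \<in> piece \<V> 4"
    and virasoro: "\<exists>C::complex. \<forall>n m v.
      vir \<V> \<omega> n (vir \<V> \<omega> m v) - vir \<V> \<omega> m (vir \<V> \<omega> n v)
        = scalar \<V> (of_int (n - m)) (vir \<V> \<omega> (n + m) v)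
          + scalar \<V> (if n + m = 0 then of_int (n ^ 3 - n) / 12 * C else 0) v"
    and vir_minus_one: "vir \<V> \<omega> (- 1) = transl \<V>"
    and vir_zero_diagonalizable: "diagonalizable (scalar \<V>) (vir \<V> \<omega> 0)"

definition weight_space :: "'v vertex_data \<Rightarrow> 'v \<Rightarrow> int \<Rightarrow> 'v set" where
  "weight_space \<V> \<omega> i = {a. vir \<V> \<omega> 0 a = scalar \<V> (of_int i) a}"

definition primary :: "'v::zero vertex_data \<Rightarrow> 'v \<Rightarrow> int \<Rightarrow> 'v set" where
  "primary \<V> \<omega> i = {a \<in> weight_space \<V> \<omega> i. \<forall>n\<ge>1. vir \<V> \<omega> n a = 0}"


section \<open>Graded Lie superalgebras\<close>

text \<open>
  A \<open>\<int>\<close>-graded Lie superalgebra (parity is degree mod 2) is a complex vector space on a carrier set,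
  with homogeneous pieces \<open>lpiece L i\<close> and bracket \<open>bracket L\<close>. The fields \<open>mult\<close> and \<open>one\<close>
  that a module record inherits from rings play no role.
\<close>

record 'a lie_data = "(complex, 'a) module" +
  bracket :: "'a \<Rightarrow> 'a \<Rightarrow> 'a"
  lpiece :: "int \<Rightarrow> 'a set"

abbreviation complex_ring :: "complex ring" where
  "complex_ring \<equiv> ring_of_type_algebra"

definition lie_decomposition :: "'a lie_data \<Rightarrow> (int \<Rightarrow> 'a set) \<Rightarrow> (int \<Rightarrow> 'a) \<Rightarrow> 'a \<Rightarrow> bool" where
  "lie_decomposition L G f x \<longleftrightarrow>
     (\<forall>i. f i \<in> G i) \<and> finite {i. f i \<noteq> \<zero>\<^bsub>L\<^esub>} \<and> x = finsum L f {i. f i \<noteq> \<zero>\<^bsub>L\<^esub>}"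

locale lie_superalgebra = Module.module complex_ring L
  for L :: "'a lie_data" (structure) +
  assumes lpiece_submodule: "\<And>i. submodule (lpiece L i) complex_ring L"
    and lie_direct_sum: "\<And>x. x \<in> carrier L \<Longrightarrow> \<exists>!f. lie_decomposition L (lpiece L) f x"
    and bracket_closed: "\<And>x y. x \<in> carrier L \<Longrightarrow> y \<in> carrier L \<Longrightarrow> bracket L x y \<in> carrier L"
    and bracket_add_left: "\<And>x y z. x \<in> carrier L \<Longrightarrow> y \<in> carrier L \<Longrightarrow> z \<in> carrier L \<Longrightarrow>
      bracket L (x \<oplus> y) z = bracket L x z \<oplus> bracket L y z"
    and bracket_add_right: "\<And>x y z. x \<in> carrier L \<Longrightarrow> y \<in> carrier L \<Longrightarrow> z \<in> carrier L \<Longrightarrow>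
      bracket L x (y \<oplus> z) = bracket L x y \<oplus> bracket L x z"
    and bracket_smult_left: "\<And>c x y. x \<in> carrier L \<Longrightarrow> y \<in> carrier L \<Longrightarrow>
      bracket L (c \<odot> x) y = c \<odot> bracket L x y"
    and bracket_smult_right: "\<And>c x y. x \<in> carrier L \<Longrightarrow> y \<in> carrier L \<Longrightarrow>
      bracket L x (c \<odot> y) = c \<odot> bracket L x y"
    and bracket_degree: "\<And>i j x y. x \<in> lpiece L i \<Longrightarrow> y \<in> lpiece L j \<Longrightarrow>
      bracket L x y \<in> lpiece L (i + j)"
    and super_skew: "\<And>i j x y. x \<in> lpiece L i \<Longrightarrow> y \<in> lpiece L j \<Longrightarrow>
      bracket L x y = (- koszul_sign i j) \<odot> bracket L y x"
    and super_jacobi: "\<And>i j x y z. x \<in> lpiece L i \<Longrightarrow> y \<in> lpiece L j \<Longrightarrow> z \<in> carrier L \<Longrightarrow>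
      bracket L x (bracket L y z)
        = bracket L (bracket L x y) z \<oplus> koszul_sign i j \<odot> bracket L y (bracket L x z)"

definition lie_subalgebra :: "'a set \<Rightarrow> 'a lie_data \<Rightarrow> bool" where
  "lie_subalgebra H L \<longleftrightarrow> lie_superalgebra L \<and> submodule H complex_ring L \<and>
     (\<forall>x\<in>H. \<exists>f. lie_decomposition L (\<lambda>i. lpiece L i \<inter> H) f x) \<and>
     (\<forall>x\<in>H. \<forall>y\<in>H. bracket L x y \<in> H)"

definition lie_hom :: "'a lie_data \<Rightarrow> 'b lie_data \<Rightarrow> ('a \<Rightarrow> 'b) set" where
  "lie_hom L M = {h \<in> carrier L \<rightarrow> carrier M.
     (\<forall>x\<in>carrier L. \<forall>y\<in>carrier L. h (x \<oplus>\<^bsub>L\<^esub> y) = h x \<oplus>\<^bsub>M\<^esub> h y) \<and>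
     (\<forall>c. \<forall>x\<in>carrier L. h (c \<odot>\<^bsub>L\<^esub> x) = c \<odot>\<^bsub>M\<^esub> h x) \<and>
     (\<forall>i. h ` lpiece L i \<subseteq> lpiece M i) \<and>
     (\<forall>x\<in>carrier L. \<forall>y\<in>carrier L. h (bracket L x y) = bracket M (h x) (h y))}"

definition graded_subspace :: "'v::ab_group_add vertex_data \<Rightarrow> 'v set \<Rightarrow> bool" where
  "graded_subspace \<V> W \<longleftrightarrow> module.subspace (scalar \<V>) W \<and>
     (\<forall>v\<in>W. \<exists>f. homogeneous_decomposition (\<lambda>i. piece \<V> i \<inter> W) f v)"

text \<open>Representations of \<open>L\<close> on graded subspaces \<open>W\<close> of \<open>V\<close>.\<close>

definition lie_representation ::
  "'v::ab_group_add vertex_data \<Rightarrow> 'a lie_data \<Rightarrow> ('a \<Rightarrow> 'v \<Rightarrow> 'v) \<Rightarrow> 'v set \<Rightarrow> bool" where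
  "lie_representation \<V> L act W \<longleftrightarrow> lie_superalgebra L \<and> graded_subspace \<V> W \<and>
     (\<forall>x\<in>carrier L. \<forall>v\<in>W. act x v \<in> W) \<and>
     (\<forall>x\<in>carrier L. \<forall>y\<in>carrier L. \<forall>v\<in>W. act (x \<oplus>\<^bsub>L\<^esub> y) v = act x v + act y v) \<and>
     (\<forall>c. \<forall>x\<in>carrier L. \<forall>v\<in>W. act (c \<odot>\<^bsub>L\<^esub> x) v = scalar \<V> c (act x v)) \<and>
     (\<forall>x\<in>carrier L. \<forall>v\<in>W. \<forall>w\<in>W. act x (v + w) = act x v + act x w) \<and>
     (\<forall>c. \<forall>x\<in>carrier L. \<forall>v\<in>W. act x (scalar \<V> c v) = scalar \<V> c (act x v)) \<and>
     (\<forall>i j. \<forall>x\<in>lpiece L i. \<forall>v\<in>piece \<V> j \<inter> W. act x v \<in> piece \<V> (i + j)) \<and>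
     (\<forall>i j. \<forall>x\<in>lpiece L i. \<forall>y\<in>lpiece L j. \<forall>v\<in>W.
        act (bracket L x y) v = act x (act y v) - scalar \<V> (koszul_sign i j) (act y (act x v)))"

definition lie_subrepresentation ::
  "'v::ab_group_add vertex_data \<Rightarrow> 'a lie_data \<Rightarrow> ('a \<Rightarrow> 'v \<Rightarrow> 'v) \<Rightarrow> 'v set \<Rightarrow> 'v set \<Rightarrow> bool" where
  "lie_subrepresentation \<V> L act U W \<longleftrightarrow> lie_representation \<V> L act W \<and>
     graded_subspace \<V> U \<and> U \<subseteq> W \<and> (\<forall>x\<in>carrier L. \<forall>u\<in>U. act x u \<in> U)"


section \<open>Borcherds' Lie algebra\<close>

text \<open>
  \<open>borcherds \<V> W U\<close> is the quotient \<open>W / U\<close> of two subspaces \<open>U \<subseteq> W\<close> of \<open>V\<close>, with the bracket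
  induced by \<open>a_(0) b\<close> and with degrees shifted by 2. Its elements are the cosets of \<open>U\<close> in \<open>W\<close>.
  The operations take the union of the classes of the results over all representatives; this
  union is a single coset exactly if the operation is well defined.
\<close>

definition mod_rel :: "'v::ab_group_add set \<Rightarrow> 'v set \<Rightarrow> ('v \<times> 'v) set" where
  "mod_rel W U = {(a, b). a \<in> W \<and> b \<in> W \<and> a - b \<in> U}"

definition cls :: "'v::ab_group_add set \<Rightarrow> 'v set \<Rightarrow> 'v \<Rightarrow> 'v set" where
  "cls W U a = mod_rel W U `` {a}"

definition borcherds :: "'v::ab_group_add vertex_data \<Rightarrow> 'v set \<Rightarrow> 'v set \<Rightarrow> 'v set lie_data" where
  "borcherds \<V> W U = \<lparr>
     carrier = W // mod_rel W U,
     monoid.mult = undefined,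
     monoid.one = undefined,
     ring.zero = cls W U 0,
     ring.add = (\<lambda>A B. \<Union>a\<in>A. \<Union>b\<in>B. cls W U (a + b)),
     module.smult = (\<lambda>c A. \<Union>a\<in>A. cls W U (scalar \<V> c a)),
     bracket = (\<lambda>A B. \<Union>a\<in>A. \<Union>b\<in>B. cls W U (nmode \<V> a 0 b)),
     lpiece = (\<lambda>i. cls W U ` (W \<inter> piece \<V> (i + 2))) \<rparr>"

text \<open>The map induced by an inclusion \<open>W \<subseteq> W'\<close>, from \<open>W / U\<close> to \<open>W' / U'\<close>.\<close>

definition natural_map :: "'v::ab_group_add set \<Rightarrow> 'v set \<Rightarrow> 'v set \<Rightarrow> 'v set" where
  "natural_map W' U' A = (\<Union>a\<in>A. cls W' U' a)"

definition V_check :: "'v::ab_group_add vertex_data \<Rightarrow> 'v set lie_data" where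
  "V_check \<V> = borcherds \<V> UNIV (range (transl \<V>))"

definition V_check_0 :: "'v::ab_group_add vertex_data \<Rightarrow> 'v \<Rightarrow> 'v set lie_data" where
  "V_check_0 \<V> \<omega> = borcherds \<V> (weight_space \<V> \<omega> 1) (transl \<V> ` weight_space \<V> \<omega> 0)"

definition P_check_0 :: "'v::ab_group_add vertex_data \<Rightarrow> 'v \<Rightarrow> 'v set lie_data" where
  "P_check_0 \<V> \<omega> = borcherds \<V> (primary \<V> \<omega> 1) (transl \<V> ` primary \<V> \<omega> 0)"

definition P_check_0_incl :: "'v::ab_group_add vertex_data \<Rightarrow> 'v \<Rightarrow> 'v set \<Rightarrow> 'v set" where
  "P_check_0_incl \<V> \<omega> = natural_map (weight_space \<V> \<omega> 1) (transl \<V> ` weight_space \<V> \<omega> 0)"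

text \<open>The action \<open>a_(0) b\<close> of a class in \<open>V_check \<V>\<close> on \<open>V\<close>; \<open>the_elem\<close> picks its unique value.\<close>

definition V_check_action :: "'v::ab_group_add vertex_data \<Rightarrow> 'v set \<Rightarrow> 'v \<Rightarrow> 'v" where
  "V_check_action \<V> A b = the_elem ((\<lambda>a. nmode \<V> a 0 b) ` A)"

text \<open>Its restriction along the natural map \<open>P_1 / T(P_0) \<rightarrow> V / T(V)\<close>.\<close>

definition P_check_0_action :: "'v::ab_group_add vertex_data \<Rightarrow> 'v set \<Rightarrow> 'v \<Rightarrow> 'v" where
  "P_check_0_action \<V> A = V_check_action \<V> (natural_map UNIV (range (transl \<V>)) A)"

end

theory Submission
  imports Defs "HOL-Library.Function_Algebras"
begin

text \<open>
  Write \<open>L_n\<close> for the Virasoro operators, \<open>P_i\<close> for the primary states and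
  \<open>V_i^\<omega>\<close> for all states of weight \<open>i\<close>. The theorem rests on three facts about modes.

  First, \<open>[L_n, a_(0)] = 0\<close> for \<open>n \<ge> 1\<close> and \<open>a \<in> P_1\<close>
  (\<open>vir_primary_zero_mode\<close>): for a primary field of weight one, the two surviving terms of the commutator
  formula cancel. Hence \<open>a_(0)\<close> preserves every \<open>P_i\<close>, so \<open>P_1\<close> is closed under
  the bracket and every \<open>P_i\<close> is stable under the action.

  Second, \<open>T(P_0) = P_1 \<inter> T(V_0^\<omega>)\<close> (\<open>transl_primary_eq\<close>). If
  \<open>T b\<close> is primary for some \<open>b \<in> V_0^\<omega>\<close>, the relation
  \<open>[L_n, T] = (n + 1) L_(n-1)\<close> shows inductively that \<open>L_n b\<close> lies in the kernel of
  \<open>T\<close> and has weight \<open>- n\<close>; this is the point where the hypothesis enters, and it gives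
  \<open>L_n b = 0\<close>. The identity is the injectivity of the natural map, and it also makes the bracket on
  \<open>P_1 / T(P_0)\<close> skew-symmetric.

  Third, the zeroth product satisfies the Jacobi identity in \<open>V\<close> (\<open>zero_mode_commutator\<close>)
  and is skew-symmetric modulo translations (\<open>skew_symmetry_weight_one\<close>), so that suitable quotients are
  Lie superalgebras (\<open>zero_mode_quotient\<close>).

  The first and third facts are consequences of the formula
  \<open>[a_(m), b_(n)] = (\<Sum>k. (m choose k) (a_(k) b)_(m+n-k))\<close> for \<open>m \<ge> 0\<close>
  (\<open>commutator_formula\<close>) and of locality on the vacuum. The formula is derived from the locality axiom:
  both sides are local with all fields by Dong's lemma, they agree on the vacuum, and a local family that kills the
  vacuum is zero by Goddard's uniqueness theorem. Formal distributions are handled through their coefficients, on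
  which multiplication by \<open>z - w\<close> is a difference operator.
\<close>

section \<open>Difference operators on coefficients\<close>

lemma funpow_additive:
  fixes F :: "'a::ab_group_add \<Rightarrow> 'a"
  assumes "Modules.additive F"
  shows "Modules.additive (F ^^ n)"
proof (induction n)
  case (Suc n)
  then show ?case
    using assms by (simp add: Modules.additive_def)
qed (simp add: Modules.additive_def)

lemma funpow_eq_zero_mono:
  fixes F :: "'a::ab_group_add \<Rightarrow> 'a"
  assumes "Modules.additive F" "(F ^^ n) x = 0" "n \<le> m"
  shows "(F ^^ m) x = 0"
proof -
  have "(F ^^ m) x = (F ^^ (m - n)) ((F ^^ n) x)"
    using assms(3) by (metis comp_apply funpow_add le_add_diff_inverse2)
  then show ?thesis
    using assms(2) Modules.additive.zero[OF funpow_additive[OF assms(1)]] by simp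
qed

lemma funpow_funpow_commute:
  assumes "\<And>x. F (G x) = G (F x)"
  shows "(F ^^ m) ((G ^^ n) x) = (G ^^ n) ((F ^^ m) x)"
proof -
  have *: "F ((G ^^ n) x) = (G ^^ n) (F x)" for x
    by (induction n) (simp_all add: assms)
  show ?thesis
    by (induction m) (simp_all add: *)
qed

text \<open>
  Here \<open>P\<close>, \<open>Q\<close>, \<open>R\<close> are multiplications by \<open>x - z\<close>,
  \<open>x - w\<close>, \<open>z - w\<close>. Expanding \<open>(z - w)^(2N) = ((x - w) - (x - z))^(2N)\<close>, every
  term has a factor \<open>(x - z)^N\<close>, which kills, or a factor \<open>(x - w)^N\<close>, which kills together
  with the remaining factor \<open>(z - w)^N\<close>. The expansion is carried out one factor at a time, by induction
  on the number \<open>d\<close> of factors still to be expanded.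
\<close>

lemma dong_operator_lemma:
  fixes P Q R :: "'a::ab_group_add \<Rightarrow> 'a"
  assumes add: "Modules.additive P" "Modules.additive Q" "Modules.additive R"
    and comm: "\<And>x. P (Q x) = Q (P x)"
    and R: "\<And>x. R x = Q x - P x"
    and P0: "(P ^^ N) x = 0"
    and QR0: "(R ^^ N) ((Q ^^ N) x) = 0"
  shows "(R ^^ (3 * N)) x = 0"
proof -
  have PR: "P (R x) = R (P x)" and QR: "Q (R x) = R (Q x)" for x
    by (simp_all add: R Modules.additive.diff[OF add(1)] Modules.additive.diff[OF add(2)] comm)
  have *: "(R ^^ (N + d)) ((P ^^ j) ((Q ^^ k) x)) = 0" if "2 * N \<le> d + j + k" for d j k
    using that
  proof (induction d arbitrary: j k)
    case 0
    show ?case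
    proof (cases "N \<le> j")
      case True
      then have "(P ^^ j) x = 0"
        by (rule funpow_eq_zero_mono[OF add(1) P0])
      then show ?thesis
        by (simp add: funpow_funpow_commute[of P Q, OF comm] Modules.additive.zero[OF funpow_additive[OF add(2)]]
            Modules.additive.zero[OF funpow_additive[OF add(3)]])
    next
      case False
      then have "N \<le> k" using 0 by simp
      moreover have "(Q ^^ N) ((R ^^ N) x) = 0"
        using QR0 by (simp add: funpow_funpow_commute[of Q R, OF QR])
      ultimately have "(Q ^^ k) ((R ^^ N) x) = 0"
        using funpow_eq_zero_mono[OF add(2)] by blast
      then show ?thesis
        by (simp add: funpow_funpow_commute[of P R, OF PR, symmetric] funpow_funpow_commute[of Q R, OF QR, symmetric]
            Modules.additive.zero[OF funpow_additive[OF add(1)]])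
    qed
  next
    case (Suc d)
    let ?y = "(P ^^ j) ((Q ^^ k) x)"
    have "(R ^^ (N + Suc d)) ?y = (R ^^ (N + d)) (Q ?y - P ?y)"
      by (simp add: funpow_swap1 R)
    also have "\<dots> = (R ^^ (N + d)) (Q ?y) - (R ^^ (N + d)) (P ?y)"
      by (rule Modules.additive.diff[OF funpow_additive[OF add(3)]])
    also have "Q ?y = (P ^^ j) ((Q ^^ Suc k) x)"
      using funpow_funpow_commute[of P Q, OF comm, of j 1 "(Q ^^ k) x"] by simp
    also have "P ?y = (P ^^ Suc j) ((Q ^^ k) x)"
      by simp
    finally show ?case
      using Suc.IH[of j "Suc k"] Suc.IH[of "Suc j" k] Suc.prems by simp
  qed
  show ?thesis
    using *[of "2 * N" 0 0] by (simp add: numeral_3_eq_3)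
qed

text \<open>
  On coefficients, multiplication of a formal distribution in \<open>z\<close>, \<open>w\<close> by
  \<open>z - w\<close> is a difference of index shifts. The three variants below do this for pairs out of three
  variables.
\<close>

definition delta :: "(int \<Rightarrow> int \<Rightarrow> 'v::ab_group_add) \<Rightarrow> int \<Rightarrow> int \<Rightarrow> 'v" where
  "delta f = (\<lambda>m n. f (m + 1) n - f m (n + 1))"


definition delta12 :: "(int \<Rightarrow> int \<Rightarrow> int \<Rightarrow> 'v::ab_group_add) \<Rightarrow> int \<Rightarrow> int \<Rightarrow> int \<Rightarrow> 'v" where
  "delta12 f = (\<lambda>l m n. f (l + 1) m n - f l (m + 1) n)"

definition delta13 :: "(int \<Rightarrow> int \<Rightarrow> int \<Rightarrow> 'v::ab_group_add) \<Rightarrow> int \<Rightarrow> int \<Rightarrow> int \<Rightarrow> 'v" where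
  "delta13 f = (\<lambda>l m n. f (l + 1) m n - f l m (n + 1))"

definition delta23 :: "(int \<Rightarrow> int \<Rightarrow> int \<Rightarrow> 'v::ab_group_add) \<Rightarrow> int \<Rightarrow> int \<Rightarrow> int \<Rightarrow> 'v" where
  "delta23 f = (\<lambda>l m n. f l (m + 1) n - f l m (n + 1))"


lemma delta_apply: "delta f m n = f (m + 1) n - f m (n + 1)"
  by (simp add: delta_def)

lemma delta12_apply: "delta12 f l m n = f (l + 1) m n - f l (m + 1) n"
  by (simp add: delta12_def)

lemma delta13_apply: "delta13 f l m n = f (l + 1) m n - f l m (n + 1)"
  by (simp add: delta13_def)

lemma delta23_apply: "delta23 f l m n = f l (m + 1) n - f l m (n + 1)"
  by (simp add: delta23_def)

lemma additive_delta: "Modules.additive delta"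
  by (simp add: Modules.additive_def delta_def fun_eq_iff)

lemma additive_delta3: "Modules.additive delta12" "Modules.additive delta13" "Modules.additive delta23"
  by (simp_all add: Modules.additive_def delta12_def delta13_def delta23_def fun_eq_iff)

lemma funpow_delta12: "(delta12 ^^ N) f l m n = (delta ^^ N) (\<lambda>l m. f l m n) l m"
proof (induction N arbitrary: l m)
  case (Suc N)
  show ?case
    by (simp add: delta12_apply[of "(delta12 ^^ N) f"] delta_apply[of "(delta ^^ N) (\<lambda>l m. f l m n)"] Suc)
qed simp

lemma funpow_delta13: "(delta13 ^^ N) f l m n = (delta ^^ N) (\<lambda>l n. f l m n) l n"
proof (induction N arbitrary: l n)
  case (Suc N)
  show ?case
    by (simp add: delta13_apply[of "(delta13 ^^ N) f"] delta_apply[of "(delta ^^ N) (\<lambda>l n. f l m n)"] Suc)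
qed simp

lemma funpow_delta23: "(delta23 ^^ N) f l m n = (delta ^^ N) (\<lambda>m n. f l m n) m n"
proof (induction N arbitrary: m n)
  case (Suc N)
  show ?case
    by (simp add: delta23_apply[of "(delta23 ^^ N) f"] delta_apply[of "(delta ^^ N) (\<lambda>m n. f l m n)"] Suc)
qed simp

lemma funpow_delta_additive_image:
  assumes "Modules.additive F"
  shows "(delta ^^ N) (\<lambda>m n. F (f m n)) m n = F ((delta ^^ N) f m n)"
proof (induction N arbitrary: m n)
  case (Suc N)
  show ?case
    by (simp add: delta_apply[of "(delta ^^ N) (\<lambda>m n. F (f m n))"] delta_apply[of "(delta ^^ N) f"]
        Suc Modules.additive.diff[OF assms])
qed simp

lemma funpow_delta_shift:
  "(delta ^^ N) (\<lambda>m n. f (m + p) n) m n = (delta ^^ N) f (m + p) n"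
proof (induction N arbitrary: m n)
  case (Suc N)
  show ?case
    by (simp add: delta_apply[of "(delta ^^ N) (\<lambda>m n. f (m + p) n)"] delta_apply[of "(delta ^^ N) f"]
        Suc ac_simps)
qed simp

lemma dong_delta:
  fixes f :: "int \<Rightarrow> int \<Rightarrow> int \<Rightarrow> 'v::ab_group_add"
  assumes "(delta12 ^^ N) f = 0" and "(delta23 ^^ N) ((delta13 ^^ N) f) = 0"
  shows "(delta23 ^^ (3 * N)) f = 0"
proof (rule dong_operator_lemma[OF _ _ _ _ _ assms])
  show "delta12 (delta13 x) = delta13 (delta12 x)" "delta23 x = delta13 x - delta12 x"
    for x :: "int \<Rightarrow> int \<Rightarrow> int \<Rightarrow> 'v"
    by (simp_all add: delta12_def delta13_def delta23_def fun_eq_iff)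
qed (rule additive_delta3)+

context vector_space begin

text \<open>
  The binomial sum in the locality axiom is an iterated difference.
\<close>

lemma funpow_delta_binomial:
  "(delta ^^ N) f m n
     = (\<Sum>k\<le>N. scale ((- 1) ^ k * of_nat (N choose k)) (f (m + int (N - k)) (n + int k)))"
proof (induction N arbitrary: f)
  case (Suc N)
  define c where "c N k = ((- 1) ^ k * of_nat (N choose k) :: 'a)" for N k
  have c_Suc: "c (Suc N) 0 = c N 0" "c (Suc N) (Suc k) = c N (Suc k) - c N k" for k
    by (simp_all add: c_def algebra_simps)
  define g where "g k = f (m + int N + 1 - int k) (n + int k)" for k
  have "(delta ^^ Suc N) f m n = (\<Sum>k\<le>N. scale (c N k) (delta f (m + int (N - k)) (n + int k)))"
    by (simp add: funpow_swap1 Suc c_def)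
  also have "\<dots> = (\<Sum>k\<le>N. scale (c N k) (g k) - scale (c N k) (g (Suc k)))"
    by (intro sum.cong refl)
      (simp add: delta_def g_def scale_right_diff_distrib of_nat_diff algebra_simps)
  also have "\<dots> = (\<Sum>k\<le>Suc N. scale (c N k) (g k)) - (\<Sum>k\<le>N. scale (c N k) (g (Suc k)))"
    by (simp add: sum_subtractf c_def binomial_eq_0)
  also have "\<dots> = scale (c N 0) (g 0) + (\<Sum>k\<le>N. scale (c N (Suc k) - c N k) (g (Suc k)))"
    by (simp only: sum.atMost_Suc_shift scale_left_diff_distrib sum_subtractf add_diff_eq)
  also have "\<dots> = scale (c (Suc N) 0) (g 0) + (\<Sum>k\<le>N. scale (c (Suc N) (Suc k)) (g (Suc k)))"
    by (simp only: c_Suc)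
  also have "\<dots> = (\<Sum>k\<le>Suc N. scale (c (Suc N) k) (g k))"
    by (simp only: sum.atMost_Suc_shift)
  also have "\<dots> = (\<Sum>k\<le>Suc N. scale (c (Suc N) k) (f (m + int (Suc N - k)) (n + int k)))"
    by (intro sum.cong refl) (simp add: g_def of_nat_diff algebra_simps)
  finally show ?case by (simp only: c_def)
qed simp

end

section \<open>Mutually local families of operators\<close>

context vertex_superalgebra begin

lemmas mode_right_hom = module_hom_linearI[OF mode_linear_right]
  and mode_left_hom = module_hom_linearI[OF mode_linear_left]
  and transl_hom = module_hom_linearI[OF transl_linear]

lemmas mode_right_simps [simp] =
  module_hom.add[OF mode_right_hom] module_hom.diff[OF mode_right_hom]
  module_hom.scale[OF mode_right_hom] module_hom.neg[OF mode_right_hom] module_hom.zero[OF mode_right_hom]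

lemmas mode_left_simps [simp] =
  module_hom.add[OF mode_left_hom] module_hom.diff[OF mode_left_hom]
  module_hom.scale[OF mode_left_hom] module_hom.neg[OF mode_left_hom] module_hom.zero[OF mode_left_hom]

lemmas transl_simps [simp] =
  module_hom.add[OF transl_hom] module_hom.diff[OF transl_hom]
  module_hom.scale[OF transl_hom] module_hom.neg[OF transl_hom] module_hom.zero[OF transl_hom]

lemma homogeneous_induct [case_names homogeneous zero add]:
  assumes "\<And>i a. a \<in> piece \<V> i \<Longrightarrow> P a" and "P 0" and "\<And>a b. P a \<Longrightarrow> P b \<Longrightarrow> P (a + b)"
  shows "P v"
proof -
  obtain f where f: "homogeneous_decomposition (piece \<V>) f v"
    using direct_sum by blast
  have "P (sum f I)" if "finite I" for I
    using that
  proof induction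
    case (insert i I)
    then show ?case
      using assms(1)[of "f i" i] assms(3) f by (simp add: homogeneous_decomposition_def)
  qed (simp add: assms(2))
  then show ?thesis
    using f by (simp add: homogeneous_decomposition_def)
qed

text \<open>
  Families of operators indexed by \<open>int\<close> stand for fields, without reference to the state that they
  belong to: the argument below needs fields such as a commutator \<open>[a_(m), Y(b, w)]\<close>, which are not known
  beforehand to come from a state.
\<close>

definition mode_commutator ::
  "complex \<Rightarrow> (int \<Rightarrow> 'v \<Rightarrow> 'v) \<Rightarrow> (int \<Rightarrow> 'v \<Rightarrow> 'v) \<Rightarrow> 'v \<Rightarrow> int \<Rightarrow> int \<Rightarrow> 'v" where
  "mode_commutator \<sigma> A B v = (\<lambda>m n. A m (B n v) - scalar \<V> \<sigma> (B n (A m v)))"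

definition mutually_local :: "complex \<Rightarrow> (int \<Rightarrow> 'v \<Rightarrow> 'v) \<Rightarrow> (int \<Rightarrow> 'v \<Rightarrow> 'v) \<Rightarrow> bool" where
  "mutually_local \<sigma> A B \<longleftrightarrow> (\<exists>N. \<forall>v. (delta ^^ N) (mode_commutator \<sigma> A B v) = 0)"

lemma mutually_localE:
  assumes "mutually_local \<sigma> A B"
  obtains N where "\<And>M v. N \<le> M \<Longrightarrow> (delta ^^ M) (mode_commutator \<sigma> A B v) = 0"
  using assms funpow_eq_zero_mono[OF additive_delta] unfolding mutually_local_def by metis

lemma mutually_local_modes:
  assumes "a \<in> piece \<V> i" "b \<in> piece \<V> j"
  shows "mutually_local (koszul_sign i j) (nmode \<V> a) (nmode \<V> b)"
proof -
  obtain N where "\<forall>m n c. (\<Sum>k\<le>N. scalar \<V> ((- 1) ^ k * of_nat (N choose k))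
      (mode_commutator (koszul_sign i j) (nmode \<V> a) (nmode \<V> b) c (m + int (N - k)) (n + int k))) = 0"
    using locality[OF assms] unfolding mode_commutator_def by blast
  then show ?thesis
    unfolding mutually_local_def
    by (intro exI[of _ N] allI ext) (simp add: funpow_delta_binomial)
qed

lemma mutually_local_add:
  assumes "\<And>n. module_hom (scalar \<V>) (scalar \<V>) (C n)"
    and "mutually_local \<sigma> A C" "mutually_local \<sigma> B C"
  shows "mutually_local \<sigma> (\<lambda>n v. A n v + B n v) C"
proof -
  obtain N1 where N1: "\<And>M v. N1 \<le> M \<Longrightarrow> (delta ^^ M) (mode_commutator \<sigma> A C v) = 0"
    using assms(2) by (rule mutually_localE) blast
  obtain N2 where N2: "\<And>M v. N2 \<le> M \<Longrightarrow> (delta ^^ M) (mode_commutator \<sigma> B C v) = 0"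
    using assms(3) by (rule mutually_localE) blast
  have *: "mode_commutator \<sigma> (\<lambda>n v. A n v + B n v) C v
      = mode_commutator \<sigma> A C v + mode_commutator \<sigma> B C v" for v
    by (simp add: mode_commutator_def fun_eq_iff module_hom.add[OF assms(1)] algebra_simps)
  show ?thesis
    unfolding mutually_local_def
    by (intro exI[of _ "max N1 N2"])
      (simp add: * N1 N2 Modules.additive.add[OF funpow_additive[OF additive_delta]])
qed

lemma mutually_local_scale:
  assumes "\<And>n. module_hom (scalar \<V>) (scalar \<V>) (C n)"
    and "mutually_local \<sigma> A C"
  shows "mutually_local \<sigma> (\<lambda>n v. scalar \<V> c (A n v)) C"
proof -
  obtain N where N: "\<And>v. (delta ^^ N) (mode_commutator \<sigma> A C v) = 0"
    using assms(2) unfolding mutually_local_def by blast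
  have "(delta ^^ N) (mode_commutator \<sigma> (\<lambda>n v. scalar \<V> c (A n v)) C v) m n = 0" for v m n
  proof -
    have "mode_commutator \<sigma> (\<lambda>n v. scalar \<V> c (A n v)) C v
        = (\<lambda>m n. scalar \<V> c (mode_commutator \<sigma> A C v m n))"
      by (simp add: mode_commutator_def fun_eq_iff module_hom.scale[OF assms(1)]
          scale_right_diff_distrib mult.commute)
    moreover have "Modules.additive (scalar \<V> c)"
      by (simp add: Modules.additive_def scale_right_distrib)
    ultimately show ?thesis
      by (simp add: funpow_delta_additive_image N)
  qed
  then show ?thesis
    unfolding mutually_local_def by (intro exI[of _ N]) (simp add: fun_eq_iff)
qed

lemma mutually_local_shift:
  assumes "mutually_local \<sigma> A C"
  shows "mutually_local \<sigma> (\<lambda>n. A (n + p)) C"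
proof -
  obtain N where N: "\<And>v. (delta ^^ N) (mode_commutator \<sigma> A C v) = 0"
    using assms unfolding mutually_local_def by blast
  have "(delta ^^ N) (mode_commutator \<sigma> (\<lambda>n. A (n + p)) C v) m n = 0" for v m n
    using funpow_delta_shift[of N "mode_commutator \<sigma> A C v" p m n] N[of v]
    by (simp add: mode_commutator_def)
  then show ?thesis
    unfolding mutually_local_def by (intro exI[of _ N]) (simp add: fun_eq_iff)
qed

lemma mutually_local_sum:
  assumes "\<And>n. module_hom (scalar \<V>) (scalar \<V>) (C n)"
    and "finite I" "\<And>i. i \<in> I \<Longrightarrow> mutually_local \<sigma> (A i) C"
  shows "mutually_local \<sigma> (\<lambda>n v. \<Sum>i\<in>I. A i n v) C"
  using assms(2,3)
proof (induction I)
  case empty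
  have "mode_commutator \<sigma> (\<lambda>n v. 0) C v = 0" for v
    by (simp add: mode_commutator_def fun_eq_iff module_hom.zero[OF assms(1)])
  then show ?case
    unfolding mutually_local_def by (intro exI[of _ 0]) simp
next
  case (insert i I)
  then show ?case
    using mutually_local_add[OF assms(1), where \<sigma> = \<sigma> and A = "A i" and B = "\<lambda>n v. \<Sum>i\<in>I. A i n v"]
    by simp
qed

text \<open>
  Let \<open>D l m n\<close> be the double commutator of \<open>A l\<close>, \<open>B m\<close> and
  \<open>C n\<close>. By the locality of \<open>A\<close> and \<open>B\<close>, iterated differences in the first two
  indices kill it. Written as \<open>D1 + D2 - D3 - D4\<close>, each summand contains a commutator with
  \<open>C\<close> and is killed by iterated differences in the last two indices, or in the first and the third.
\<close>

lemma dong_lemma: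
  assumes A: "\<And>n. module_hom (scalar \<V>) (scalar \<V>) (A n)"
    and B: "\<And>n. module_hom (scalar \<V>) (scalar \<V>) (B n)"
    and C: "\<And>n. module_hom (scalar \<V>) (scalar \<V>) (C n)"
    and AB: "mutually_local \<sigma> A B" and AC: "mutually_local \<tau> A C" and BC: "mutually_local \<rho> B C"
  shows "mutually_local (\<tau> * \<rho>) (\<lambda>n v. mode_commutator \<sigma> A B v l n) C"
proof -
  obtain N1 where N1: "\<And>M v. N1 \<le> M \<Longrightarrow> (delta ^^ M) (mode_commutator \<sigma> A B v) = 0"
    using AB by (rule mutually_localE) blast
  obtain N2 where N2: "\<And>M v. N2 \<le> M \<Longrightarrow> (delta ^^ M) (mode_commutator \<tau> A C v) = 0"
    using AC by (rule mutually_localE) blast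
  obtain N3 where N3: "\<And>M v. N3 \<le> M \<Longrightarrow> (delta ^^ M) (mode_commutator \<rho> B C v) = 0"
    using BC by (rule mutually_localE) blast
  define N where "N = max N1 (max N2 N3)"
  have N: "(delta ^^ N) (mode_commutator \<sigma> A B v) = 0" "(delta ^^ N) (mode_commutator \<tau> A C v) = 0"
      "(delta ^^ N) (mode_commutator \<rho> B C v) = 0" for v
    by (simp_all add: N_def N1 N2 N3)
  have add: "Modules.additive (A n)" "Modules.additive (B n)" "Modules.additive (C n)"
      "Modules.additive (scalar \<V> c)" for n c
    by (simp_all add: Modules.additive_def module_hom.add[OF A] module_hom.add[OF B]
        module_hom.add[OF C] scale_right_distrib)
  note add2 = add[unfolded Modules.additive_def]
  have "(delta ^^ (3 * N)) (mode_commutator (\<tau> * \<rho>) (\<lambda>n v. mode_commutator \<sigma> A B v l n) C v) = 0" for v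
  proof -
    define D where "D l = mode_commutator (\<tau> * \<rho>) (\<lambda>n v. mode_commutator \<sigma> A B v l n) C v" for l
    define E F where "E = (\<lambda>l m n. mode_commutator \<sigma> A B (C n v) l m)"
      and "F = (\<lambda>l m n. scalar \<V> (\<tau> * \<rho>) (C n (mode_commutator \<sigma> A B v l m)))"
    have "D = E - F"
      by (simp add: D_def E_def F_def mode_commutator_def fun_eq_iff)
    moreover have "(delta12 ^^ N) E = 0"
      by (intro ext) (simp add: E_def funpow_delta12 N)
    moreover have "(delta12 ^^ N) F = 0"
    proof (intro ext)
      fix l m n
      have "Modules.additive (\<lambda>x. scalar \<V> (\<tau> * \<rho>) (C n x))"
        by (simp add: Modules.additive_def add2)
      from funpow_delta_additive_image[OF this]
      show "(delta12 ^^ N) F l m n = 0 l m n"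
        by (simp add: F_def funpow_delta12 N module_hom.zero[OF C])
    qed
    ultimately have D12: "(delta12 ^^ N) D = 0"
      by (simp add: Modules.additive.diff[OF funpow_additive[OF additive_delta3(1)]])
    define D1 D2 D3 D4 where "D1 = (\<lambda>l m n. A l (mode_commutator \<rho> B C v m n))"
      and "D2 = (\<lambda>l m n. scalar \<V> \<rho> (mode_commutator \<tau> A C (B m v) l n))"
      and "D3 = (\<lambda>l m n. scalar \<V> \<sigma> (B m (mode_commutator \<tau> A C v l n)))"
      and "D4 = (\<lambda>l m n. scalar \<V> (\<sigma> * \<tau>) (mode_commutator \<rho> B C (A l v) m n))"
    have D: "D = D1 + D2 - D3 - D4"
      by (simp add: D_def D1_def D2_def D3_def D4_def mode_commutator_def fun_eq_iff
          module_hom.add[OF A] module_hom.add[OF B] module_hom.add[OF C]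
          module_hom.diff[OF A] module_hom.diff[OF B] module_hom.diff[OF C]
          module_hom.scale[OF A] module_hom.scale[OF B] module_hom.scale[OF C]
          scale_right_diff_distrib scale_right_distrib mult_ac)
    have D1: "(delta23 ^^ N) D1 = 0"
      by (intro ext) (simp add: D1_def funpow_delta23 funpow_delta_additive_image[OF add(1)] N
          module_hom.zero[OF A])
    have D4: "(delta23 ^^ N) D4 = 0"
      by (intro ext) (simp add: D4_def funpow_delta23 funpow_delta_additive_image[OF add(4)] N)
    have D2: "(delta13 ^^ N) D2 = 0"
      by (intro ext) (simp add: D2_def funpow_delta13 funpow_delta_additive_image[OF add(4)] N)
    have D3: "(delta13 ^^ N) D3 = 0"
    proof (intro ext)
      fix l m n
      have "Modules.additive (\<lambda>x. scalar \<V> \<sigma> (B m x))"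
        by (simp add: Modules.additive_def add2)
      from funpow_delta_additive_image[OF this]
      show "(delta13 ^^ N) D3 l m n = 0 l m n"
        by (simp add: D3_def funpow_delta13 N module_hom.zero[OF B])
    qed
    have comm: "delta23 (delta13 x) = delta13 (delta23 x)" for x :: "int \<Rightarrow> int \<Rightarrow> int \<Rightarrow> 'v"
      by (simp add: delta13_def delta23_def fun_eq_iff)
    note a23 = funpow_additive[OF additive_delta3(3)] and a13 = funpow_additive[OF additive_delta3(2)]
    have "(delta23 ^^ N) ((delta13 ^^ N) x) = 0" if "(delta23 ^^ N) x = 0"
      for x :: "int \<Rightarrow> int \<Rightarrow> int \<Rightarrow> 'v"
      using that by (simp add: funpow_funpow_commute[of delta23 delta13, OF comm]
          Modules.additive.zero[OF a13])
    then have "(delta23 ^^ N) ((delta13 ^^ N) D) = 0"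
      by (simp add: D Modules.additive.add[OF a13] Modules.additive.diff[OF a13]
          Modules.additive.add[OF a23] Modules.additive.diff[OF a23] D1 D2 D3 D4
          Modules.additive.zero[OF a23])
    from dong_delta[OF D12 this] have "(delta ^^ (3 * N)) (D l) m n = 0" for m n
      by (simp add: funpow_delta23[symmetric])
    then show ?thesis
      by (simp add: D_def fun_eq_iff)
  qed
  then show ?thesis
    unfolding mutually_local_def by blast
qed

text \<open>
  Locality on the vacuum is the vanishing of an alternating sum of \<open>A_(n-k) c_(k-1) |0\<rangle>\<close>, because
  the terms with \<open>A\<close> on the right vanish. By the creation axioms only \<open>k = 0\<close> survives, and
  it is \<open>A_(n) c\<close>.
\<close>

lemma goddard_uniqueness:
  assumes A: "\<And>n. Modules.additive (A n)"
    and local: "\<And>i c. c \<in> piece \<V> i \<Longrightarrow> \<exists>\<sigma>. mutually_local \<sigma> A (nmode \<V> c)"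
    and vac: "\<And>n. A n (vacuum \<V>) = 0"
  shows "A n v = 0"
proof (induction v rule: homogeneous_induct)
  case (homogeneous i c)
  obtain \<sigma> N where N: "(delta ^^ N) (mode_commutator \<sigma> A (nmode \<V> c) (vacuum \<V>)) = 0"
    using local[OF homogeneous] unfolding mutually_local_def by blast
  define g where "g k = scalar \<V> ((- 1) ^ k * of_nat (N choose k))
       (A (n - int N + int (N - k)) (nmode \<V> c (- 1 + int k) (vacuum \<V>)))" for k
  have "0 = (\<Sum>k\<le>N. g k)"
    using N funpow_delta_binomial[of N "mode_commutator \<sigma> A (nmode \<V> c) (vacuum \<V>)" "n - int N" "- 1"]
    by (simp add: mode_commutator_def vac g_def)
  also have "\<dots> = (\<Sum>k\<in>{0}. g k)"
    by (intro sum.mono_neutral_right) (auto simp: g_def creation(2) Modules.additive.zero[OF A])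
  also have "\<dots> = A n c"
    by (simp add: g_def creation(1))
  finally show ?case by simp
next
  case zero
  show ?case by (rule Modules.additive.zero[OF A])
next
  case (add a b)
  then show ?case by (simp add: Modules.additive.add[OF A])
qed

end

section \<open>The commutator formula\<close>

context vertex_superalgebra begin

lemma transl_mode_vacuum:
  "transl \<V> (nmode \<V> a n (vacuum \<V>)) = scalar \<V> (- of_int n) (nmode \<V> a (n - 1) (vacuum \<V>))"
  using translation_covariance[of a n "vacuum \<V>"] by (simp add: transl_vacuum)

lemma transl_mode_mode_vacuum:
  "transl \<V> (nmode \<V> a m (nmode \<V> b n (vacuum \<V>)))
    = scalar \<V> (- of_int m) (nmode \<V> a (m - 1) (nmode \<V> b n (vacuum \<V>)))
      + scalar \<V> (- of_int n) (nmode \<V> a m (nmode \<V> b (n - 1) (vacuum \<V>)))"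
  using translation_covariance[of a m "nmode \<V> b n (vacuum \<V>)"]
  by (simp add: transl_mode_vacuum algebra_simps)

text \<open>
  Both sides satisfy the same recursion under \<open>T\<close>, namely
  \<open>T (X m n) = - m X (m - 1) n - n X m (n - 1)\<close>. For \<open>n \<ge> - 1\<close> they agree by the
  creation axioms; as the coefficient \<open>n\<close> is nonzero for \<open>n \<le> - 1\<close>, the recursion
  determines \<open>X m (n - 1)\<close> from there on downwards.
\<close>

lemma commutator_formula_vacuum:
  fixes m :: nat
  shows "nmode \<V> a m (nmode \<V> b n (vacuum \<V>))
    = (\<Sum>j\<le>m. scalar \<V> (of_nat (m choose j))
         (nmode \<V> (nmode \<V> a (int j) b) (int m + n - int j) (vacuum \<V>)))"
proof -
  define e where "e j p = nmode \<V> (nmode \<V> a (int j) b) p (vacuum \<V>)" for j p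
  define L where "L m n = nmode \<V> a (int m) (nmode \<V> b n (vacuum \<V>))" for m n
  define R where "R m n = (\<Sum>j\<le>m. scalar \<V> (of_nat (m choose j)) (e j (int m + n - int j)))" for m n
  have L: "transl \<V> (L m n)
      = - scalar \<V> (of_nat m) (L (m - 1) n) - scalar \<V> (of_int n) (L m (n - 1))" for m n
    by (cases m) (simp_all add: L_def transl_mode_mode_vacuum scale_left_diff_distrib scale_left_distrib)
  have e: "transl \<V> (e j p) = scalar \<V> (- of_int p) (e j (p - 1))" for j p
    unfolding e_def by (rule transl_mode_vacuum)
  have R: "transl \<V> (R m n)
      = - scalar \<V> (of_nat m) (R (m - 1) n) - scalar \<V> (of_int n) (R m (n - 1))" for m n
  proof -
    \<comment> \<open>This identity of binomial coefficients makes the right-hand side satisfy the recursion.\<close>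
    have "of_nat (m choose j) * of_nat (m - j) = (of_nat m * of_nat ((m - 1) choose j) :: complex)" for j
      by (metis binomial_absorb_comp mult.commute of_nat_mult)
    then have absorb: "of_nat (m choose j) * (of_nat m - of_nat j)
        = (of_nat m * of_nat ((m - 1) choose j) :: complex)" if "j \<le> m" for j
      using that by (metis of_nat_diff)
    have "transl \<V> (R m n)
        = (\<Sum>j\<le>m. scalar \<V> (of_nat (m choose j) * - (of_int (int m + n - int j)))
            (e j (int m + n - int j - 1)))"
      by (simp add: R_def module_hom.sum[OF transl_hom] e)
    also have "\<dots> = (\<Sum>j\<le>m. - scalar \<V> (of_nat m * of_nat ((m - 1) choose j)) (e j (int m + n - int j - 1))
          - scalar \<V> (of_int n * of_nat (m choose j)) (e j (int m + n - int j - 1)))"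
      by (intro sum.cong refl, subst absorb[symmetric])
        (simp_all add: algebra_simps flip: scale_left_distrib scale_minus_left scale_left_diff_distrib)
    also have "\<dots> = - (\<Sum>j\<le>m. scalar \<V> (of_nat m * of_nat ((m - 1) choose j)) (e j (int m + n - int j - 1)))
          - (\<Sum>j\<le>m. scalar \<V> (of_int n * of_nat (m choose j)) (e j (int m + n - int j - 1)))"
      by (simp add: sum_subtractf sum_negf)
    also have "(\<Sum>j\<le>m. scalar \<V> (of_int n * of_nat (m choose j)) (e j (int m + n - int j - 1)))
          = scalar \<V> (of_int n) (R m (n - 1))"
      by (simp add: R_def scale_sum_right algebra_simps)
    also have "(\<Sum>j\<le>m. scalar \<V> (of_nat m * of_nat ((m - 1) choose j)) (e j (int m + n - int j - 1)))
          = scalar \<V> (of_nat m) (R (m - 1) n)"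
      by (cases m) (simp_all add: R_def scale_sum_right binomial_eq_0 algebra_simps)
    finally show ?thesis .
  qed
  have top: "L m n = R m n" if "n \<ge> - 1" for m n
  proof (cases "n = - 1")
    case True
    have "R m n = (\<Sum>j\<in>{m}. scalar \<V> (of_nat (m choose j)) (e j (int m + n - int j)))"
      unfolding R_def using True
      by (intro sum.mono_neutral_right) (auto simp: e_def creation(2))
    then show ?thesis
      by (simp add: True e_def L_def creation(1))
  next
    case False
    then have "R m n = 0"
      unfolding R_def using that by (intro sum.neutral) (auto simp: e_def creation(2))
    then show ?thesis
      using False that by (simp add: L_def creation(2))
  qed
  have step: "L m (n - 1) = R m (n - 1)" if "n \<le> - 1" "L m n = R m n"
    "scalar \<V> (of_nat m) (L (m - 1) n) = scalar \<V> (of_nat m) (R (m - 1) n)" for m n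
  proof -
    have "scalar \<V> (of_int n) (L m (n - 1)) = scalar \<V> (of_int n) (R m (n - 1))"
      using L[of m n] R[of m n] unfolding that(2,3) by (metis diff_left_imp_eq)
    moreover have "(of_int n :: complex) \<noteq> 0"
      using that(1) by simp
    ultimately show ?thesis
      using scale_left_imp_eq by blast
  qed
  have below: "L m (- 1 - int k) = R m (- 1 - int k)" for m k
  proof (induction m arbitrary: k)
    case 0
    show ?case
    proof (induction k)
      case (Suc k)
      then show ?case
        using step[of "- 1 - int k" 0] by (simp add: algebra_simps)
    qed (simp add: top)
  next
    case (Suc m)
    note outer = Suc.IH
    show ?case
    proof (induction k)
      case (Suc k)
      then show ?case
        using step[of "- 1 - int k" "Suc m"] outer[of k] by (simp add: algebra_simps)
    qed (simp add: top)
  qed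
  from below[of m "nat (- 1 - n)"] have "L m n = R m n"
    by (cases "n \<ge> - 1") (simp_all add: top)
  then show ?thesis
    by (simp add: L_def R_def e_def)
qed

text \<open>
  For fixed \<open>m\<close>, the difference of the two sides is a family indexed by \<open>n\<close>. It is local
  with every field by Dong's lemma, and it kills the vacuum, so it is zero by Goddard's uniqueness theorem.
\<close>

theorem commutator_formula:
  fixes m :: nat
  assumes a: "a \<in> piece \<V> i" and b: "b \<in> piece \<V> j"
  shows "nmode \<V> a m (nmode \<V> b n v) - scalar \<V> (koszul_sign i j) (nmode \<V> b n (nmode \<V> a m v))
    = (\<Sum>k\<le>m. scalar \<V> (of_nat (m choose k))
         (nmode \<V> (nmode \<V> a (int k) b) (int m + n - int k) v))"
proof -
  define R where "R n v = (\<Sum>k\<le>m. scalar \<V> (of_nat (m choose k))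
      (nmode \<V> (nmode \<V> a (int k) b) (n + (int m - int k)) v))" for n v
  define A where "A n v = mode_commutator (koszul_sign i j) (nmode \<V> a) (nmode \<V> b) v (int m) n
      + scalar \<V> (- 1) (R n v)" for n v
  have "A n v = 0"
  proof (rule goddard_uniqueness[where A = A])
    show "Modules.additive (A n)" for n
      by (simp add: Modules.additive_def A_def R_def mode_commutator_def scale_right_distrib sum.distrib)
  next
    fix l c assume c: "c \<in> piece \<V> l"
    have sign: "koszul_sign (j + i - 2 * int k - 2) l = koszul_sign i l * koszul_sign j l" for k
      by (simp add: koszul_sign_def)
    have "mutually_local (koszul_sign i l * koszul_sign j l)
        (\<lambda>n. nmode \<V> (nmode \<V> a (int k) b) (n + (int m - int k))) (nmode \<V> c)" for k
      using mutually_local_shift[OF mutually_local_modes[OF mode_degree[OF a b] c], of "int k" "int m - int k"]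
      by (simp add: sign)
    then have "mutually_local (koszul_sign i l * koszul_sign j l) R (nmode \<V> c)"
      unfolding R_def[abs_def]
      by (intro mutually_local_sum[OF mode_right_hom] mutually_local_scale[OF mode_right_hom]) simp_all
    then have "mutually_local (koszul_sign i l * koszul_sign j l) (\<lambda>n v. scalar \<V> (- 1) (R n v)) (nmode \<V> c)"
      by (intro mutually_local_scale mode_right_hom)
    moreover have "mutually_local (koszul_sign i l * koszul_sign j l)
        (\<lambda>n v. mode_commutator (koszul_sign i j) (nmode \<V> a) (nmode \<V> b) v (int m) n) (nmode \<V> c)"
      by (rule dong_lemma[OF mode_right_hom mode_right_hom mode_right_hom mutually_local_modes[OF a b]
            mutually_local_modes[OF a c] mutually_local_modes[OF b c]])
    ultimately have "mutually_local (koszul_sign i l * koszul_sign j l) A (nmode \<V> c)"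
      unfolding A_def by (intro mutually_local_add mode_right_hom)
    then show "\<exists>\<sigma>. mutually_local \<sigma> A (nmode \<V> c)"
      by blast
  next
    show "A n (vacuum \<V>) = 0" for n
      by (simp add: A_def R_def mode_commutator_def creation commutator_formula_vacuum algebra_simps)
  qed
  then show ?thesis
    by (simp add: A_def R_def mode_commutator_def algebra_simps)
qed

text \<open>
  An even field has sign 1 with homogeneous fields of either parity, so linearity removes the homogeneity assumption
  on the second field.
\<close>

lemma even_commutator_formula:
  fixes m :: nat
  assumes a: "a \<in> piece \<V> i" "even i"
  shows "nmode \<V> a m (nmode \<V> b n v) - nmode \<V> b n (nmode \<V> a m v)
    = (\<Sum>k\<le>m. scalar \<V> (of_nat (m choose k))
         (nmode \<V> (nmode \<V> a (int k) b) (int m + n - int k) v))"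
proof (induction b rule: homogeneous_induct)
  case (homogeneous j b)
  then show ?case
    using commutator_formula[OF a(1), of b j m n v] a(2) by (simp add: koszul_sign_def)
next
  case (add b c)
  then show ?case
    by (simp add: scale_right_distrib sum.distrib algebra_simps)
qed simp

theorem zero_mode_commutator:
  assumes "a \<in> piece \<V> i" "b \<in> piece \<V> j"
  shows "nmode \<V> a 0 (nmode \<V> b 0 v)
    = nmode \<V> (nmode \<V> a 0 b) 0 v + scalar \<V> (koszul_sign i j) (nmode \<V> b 0 (nmode \<V> a 0 v))"
  using commutator_formula[OF assms, of 0 0 v] by (simp add: algebra_simps)

end

section \<open>Skew-symmetry of the zeroth product\<close>

context vertex_superalgebra begin

text \<open>
  The full skew-symmetry formula needs exponentials of \<open>T\<close>; only its consequence modulo \<open>T\<close>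
  is needed, and this follows from locality on the vacuum. Let \<open>h m n\<close> be the supercommutator
  \<open>[a_(m), b_(n)]|0\<rangle>\<close>. On an antidiagonal its \<open>N\<close>-th difference vanishes, that is,
  it is polynomial. Put \<open>d p = h p (- 1 - p) - h (p - 1) (- p)\<close>. Then \<open>d 0\<close> is the defect of
  skew-symmetry, and translation covariance gives \<open>p d p = T (h p (- p))\<close>. Hence \<open>d p\<close> is a
  translation for \<open>p > 0\<close>, and the vanishing difference writes \<open>d 0\<close> as a combination of
  \<open>d 1, \<dots>, d N\<close>.
\<close>

lemma zero_mode_skew_symmetry:
  assumes a: "a \<in> piece \<V> i" and b: "b \<in> piece \<V> j"
  obtains N :: nat and c :: "nat \<Rightarrow> complex" where
    "nmode \<V> a 0 b + scalar \<V> (koszul_sign i j) (nmode \<V> b 0 a)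
      = transl \<V> (\<Sum>k<N. scalar \<V> (c k) (nmode \<V> a (int (N - k)) (nmode \<V> b (- int (N - k)) (vacuum \<V>))))"
proof -
  define h where "h = mode_commutator (koszul_sign i j) (nmode \<V> a) (nmode \<V> b) (vacuum \<V>)"
  obtain N where N: "(delta ^^ N) h = 0"
    using mutually_local_modes[OF a b] unfolding mutually_local_def h_def by blast
  define d where "d p = h p (- 1 - p) - h (p - 1) (- p)" for p
  define c where "c k = ((- 1) ^ k * of_nat (N choose k) :: complex)" for k
  have T: "transl \<V> (h m n) = scalar \<V> (- of_int m) (h (m - 1) n) + scalar \<V> (- of_int n) (h m (n - 1))" for m n
    by (simp add: h_def mode_commutator_def transl_mode_mode_vacuum scale_right_diff_distrib
        scale_right_distrib mult.commute)
  have d0: "d 0 = nmode \<V> a 0 b + scalar \<V> (koszul_sign i j) (nmode \<V> b 0 a)"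
    by (simp add: d_def h_def mode_commutator_def creation)
  have d_transl: "d (int p) = transl \<V> (scalar \<V> (1 / of_nat p) (nmode \<V> a (int p) (nmode \<V> b (- int p) (vacuum \<V>))))"
    if "p > 0" for p :: nat
  proof -
    have "transl \<V> (h (int p) (- int p)) = scalar \<V> (of_nat p) (d (int p))"
      by (simp add: T d_def scale_right_diff_distrib minus_diff_commute)
    then have "d (int p) = scalar \<V> (1 / of_nat p) (transl \<V> (h (int p) (- int p)))"
      using that by simp
    also have "h (int p) (- int p) = nmode \<V> a (int p) (nmode \<V> b (- int p) (vacuum \<V>))"
      by (simp add: h_def mode_commutator_def creation)
    finally show ?thesis by simp
  qed
  \<comment> \<open>The two vanishing differences are taken along the antidiagonals through the two terms of \<open>d\<close>.\<close>
  have "0 = (delta ^^ N) h 0 (- 1 - int N) - (delta ^^ N) h (- 1) (- int N)"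
    by (simp add: N)
  also have "\<dots> = (\<Sum>k\<le>N. scalar \<V> (c k) (d (int (N - k))))"
    unfolding funpow_delta_binomial sum_subtractf[symmetric]
    by (intro sum.cong refl) (simp add: c_def d_def scale_right_diff_distrib of_nat_diff algebra_simps)
  also have "\<dots> = scalar \<V> ((- 1) ^ N) (d 0) + (\<Sum>k<N. scalar \<V> (c k) (d (int (N - k))))"
    by (simp add: lessThan_Suc_atMost[symmetric] c_def add.commute)
  finally have "scalar \<V> ((- 1) ^ N) (d 0) = - (\<Sum>k<N. scalar \<V> (c k) (d (int (N - k))))"
    by (simp add: eq_neg_iff_add_eq_0)
  then have "scalar \<V> ((- 1) ^ N) (scalar \<V> ((- 1) ^ N) (d 0))
      = (\<Sum>k<N. scalar \<V> (- ((- 1) ^ N) * c k) (d (int (N - k))))"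
    by (simp add: scale_sum_right sum_negf)
  then have "d 0 = (\<Sum>k<N. scalar \<V> (- ((- 1) ^ N) * c k) (d (int (N - k))))"
    by (simp add: power_mult_distrib[symmetric])
  also have "\<dots> = transl \<V> (\<Sum>k<N. scalar \<V> (- ((- 1) ^ N) * c k / of_nat (N - k))
      (nmode \<V> a (int (N - k)) (nmode \<V> b (- int (N - k)) (vacuum \<V>))))"
    unfolding module_hom.sum[OF transl_hom]
    by (intro sum.cong refl) (simp add: d_transl del: of_nat_diff)
  finally show thesis
    unfolding d0 by (rule that)
qed

end

section \<open>Virasoro operators and primary states\<close>

context conformal_vertex_superalgebra begin

lemma vir_simps [simp]:
  "vir \<V> \<omega> n (v + w) = vir \<V> \<omega> n v + vir \<V> \<omega> n w"
  "vir \<V> \<omega> n (v - w) = vir \<V> \<omega> n v - vir \<V> \<omega> n w"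
  "vir \<V> \<omega> n (- v) = - vir \<V> \<omega> n v"
  "vir \<V> \<omega> n (scalar \<V> c v) = scalar \<V> c (vir \<V> \<omega> n v)"
  "vir \<V> \<omega> n 0 = 0"
  by (simp_all add: vir_def)

lemma vir_mode_commutator:
  fixes m :: nat
  shows "vir \<V> \<omega> (int m - 1) (nmode \<V> a n v) - nmode \<V> a n (vir \<V> \<omega> (int m - 1) v)
    = (\<Sum>k\<le>m. scalar \<V> (of_nat (m choose k))
         (nmode \<V> (vir \<V> \<omega> (int k - 1) a) (int m + n - int k) v))"
  using even_commutator_formula[OF conformal_degree, of m a n v] by (simp add: vir_def)

text \<open>
  Since \<open>\<omega>_(0) = L_(-1) = T\<close>, the commutator formula says \<open>[T, a_(n)] = (T a)_(n)\<close>;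
  comparing with translation covariance computes the modes of \<open>T a\<close>.
\<close>

lemma mode_transl: "nmode \<V> (transl \<V> a) n v = scalar \<V> (- of_int n) (nmode \<V> a (n - 1) v)"
  using vir_mode_commutator[of 0 a n v] translation_covariance[of a n v] by (simp add: vir_minus_one)

text \<open>
  The central term of \<open>[L_n, L_(-1)]\<close> could only occur for \<open>n = 1\<close>, where
  \<open>n^3 - n = 0\<close>.
\<close>

lemma vir_transl:
  "vir \<V> \<omega> n (transl \<V> v) = transl \<V> (vir \<V> \<omega> n v) + scalar \<V> (of_int (n + 1)) (vir \<V> \<omega> (n - 1) v)"
proof -
  obtain C where "\<And>n m v. vir \<V> \<omega> n (vir \<V> \<omega> m v) - vir \<V> \<omega> m (vir \<V> \<omega> n v)
        = scalar \<V> (of_int (n - m)) (vir \<V> \<omega> (n + m) v)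
          + scalar \<V> (if n + m = 0 then of_int (n ^ 3 - n) / 12 * C else 0) v"
    using virasoro by blast
  from this[of n "- 1" v] show ?thesis
    by (auto simp: vir_minus_one algebra_simps split: if_splits)
qed

lemma weight_space_iff: "a \<in> weight_space \<V> \<omega> p \<longleftrightarrow> vir \<V> \<omega> 0 a = scalar \<V> (of_int p) a"
  by (simp add: weight_space_def)

lemma weight_vir:
  assumes "v \<in> weight_space \<V> \<omega> p"
  shows "vir \<V> \<omega> n v \<in> weight_space \<V> \<omega> (p - n)"
proof -
  obtain C where "\<And>n m v. vir \<V> \<omega> n (vir \<V> \<omega> m v) - vir \<V> \<omega> m (vir \<V> \<omega> n v)
        = scalar \<V> (of_int (n - m)) (vir \<V> \<omega> (n + m) v)
          + scalar \<V> (if n + m = 0 then of_int (n ^ 3 - n) / 12 * C else 0) v"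
    using virasoro by blast
  from this[of 0 n v] show ?thesis
    using assms by (simp add: weight_space_iff algebra_simps scale_left_diff_distrib)
qed

lemma weight_transl:
  "v \<in> weight_space \<V> \<omega> p \<Longrightarrow> transl \<V> v \<in> weight_space \<V> \<omega> (p + 1)"
  using weight_vir[of v p "- 1"] by (simp add: vir_minus_one)

text \<open>
  The commutator formula gives \<open>[L_0, a_(n)] = (T a)_(n+1) + (L_0 a)_(n) = (p - n - 1) a_(n)\<close>.
\<close>

lemma weight_mode:
  assumes a: "a \<in> weight_space \<V> \<omega> p" and b: "b \<in> weight_space \<V> \<omega> q"
  shows "nmode \<V> a n b \<in> weight_space \<V> \<omega> (p + q - n - 1)"
proof -
  have "vir \<V> \<omega> 0 (nmode \<V> a n b) - nmode \<V> a n (vir \<V> \<omega> 0 b)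
      = nmode \<V> (transl \<V> a) (1 + n) b + nmode \<V> (vir \<V> \<omega> 0 a) n b"
    using vir_mode_commutator[of 1 a n b] by (simp add: vir_minus_one)
  then show ?thesis
    using assms
    by (simp add: weight_space_iff mode_transl algebra_simps scale_left_diff_distrib scale_left_distrib)
qed

lemma weight_vacuum: "vacuum \<V> \<in> weight_space \<V> \<omega> 0"
  by (simp add: weight_space_iff vir_def creation)

lemma subspace_weight_space: "subspace (weight_space \<V> \<omega> p)"
  by (rule subspaceI) (simp_all add: weight_space_iff scale_right_distrib mult.commute)

lemma subspace_primary: "subspace (primary \<V> \<omega> p)"
  using subspace_weight_space[of p]
  by (intro subspaceI) (auto simp: primary_def subspace_def)

text \<open>
  The states \<open>a_(k) b_(-k) |0\<rangle>\<close> whose combinations are translated in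
  \<open>zero_mode_skew_symmetry\<close> have weight \<open>(1 - k - 1) + (1 + k - 1) = 0\<close>.
\<close>

lemma skew_symmetry_weight_one:
  assumes a: "a \<in> piece \<V> i" "a \<in> weight_space \<V> \<omega> 1"
    and b: "b \<in> piece \<V> j" "b \<in> weight_space \<V> \<omega> 1"
  shows "nmode \<V> a 0 b + scalar \<V> (koszul_sign i j) (nmode \<V> b 0 a) \<in> transl \<V> ` weight_space \<V> \<omega> 0"
proof -
  obtain N c where eq: "nmode \<V> a 0 b + scalar \<V> (koszul_sign i j) (nmode \<V> b 0 a)
      = transl \<V> (\<Sum>k<N. scalar \<V> (c k) (nmode \<V> a (int (N - k)) (nmode \<V> b (- int (N - k)) (vacuum \<V>))))"
    using zero_mode_skew_symmetry[OF a(1) b(1)] .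
  have "nmode \<V> a p (nmode \<V> b (- p) (vacuum \<V>)) \<in> weight_space \<V> \<omega> 0" for p
    using weight_mode[OF a(2) weight_mode[OF b(2) weight_vacuum, of "- p"], of p] by simp
  then show ?thesis
    unfolding eq by (intro imageI subspace_sum subspace_scale subspace_weight_space)
qed

text \<open>
  In the commutator formula for \<open>[L_n, a_(0)]\<close> the terms with \<open>L_k a\<close>,
  \<open>k \<ge> 1\<close>, vanish. The two remaining terms are \<open>(T a)_(n+1) = - (n + 1) a_(n)\<close> and
  \<open>(n + 1) (L_0 a)_(n) = (n + 1) a_(n)\<close>; they cancel exactly because \<open>a\<close> has weight one.
\<close>

lemma vir_primary_zero_mode:
  assumes a: "a \<in> primary \<V> \<omega> 1" and n: "n \<ge> 1"
  shows "vir \<V> \<omega> n (nmode \<V> a 0 b) = nmode \<V> a 0 (vir \<V> \<omega> n b)"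
proof -
  define m where "m = nat n - 1"
  have n_m: "n = int (Suc (Suc m)) - 1"
    using n by (simp add: m_def)
  have L: "vir \<V> \<omega> 0 a = a" "\<And>k. k \<ge> 1 \<Longrightarrow> vir \<V> \<omega> k a = 0"
    using a by (simp_all add: primary_def weight_space_def)
  define g where "g k = scalar \<V> (of_nat (Suc (Suc m) choose k))
      (nmode \<V> (vir \<V> \<omega> (int k - 1) a) (int (Suc (Suc m)) - int k) b)" for k
  have "vir \<V> \<omega> n (nmode \<V> a 0 b) - nmode \<V> a 0 (vir \<V> \<omega> n b) = (\<Sum>k\<le>Suc (Suc m). g k)"
    unfolding n_m g_def by (subst vir_mode_commutator) simp
  also have "\<dots> = (\<Sum>k\<in>{0, 1}. g k)"
    by (intro sum.mono_neutral_right) (auto simp: g_def L(2))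
  also have "\<dots> = 0"
    by (simp add: g_def L(1) vir_minus_one mode_transl flip: scale_left_distrib)
  finally show ?thesis by simp
qed

lemma primary_zero_mode:
  assumes a: "a \<in> primary \<V> \<omega> 1" and b: "b \<in> primary \<V> \<omega> p"
  shows "nmode \<V> a 0 b \<in> primary \<V> \<omega> p"
  using weight_mode[of a 1 b p 0] vir_primary_zero_mode[OF a] a b by (simp add: primary_def)

lemma transl_primary: "transl \<V> ` primary \<V> \<omega> 0 \<subseteq> primary \<V> \<omega> 1"
proof clarify
  fix a assume a: "a \<in> primary \<V> \<omega> 0"
  then have L0: "vir \<V> \<omega> 0 a = 0" and L: "\<And>n. n \<ge> 1 \<Longrightarrow> vir \<V> \<omega> n a = 0"
    by (simp_all add: primary_def weight_space_def)
  have "vir \<V> \<omega> n (transl \<V> a) = 0" if "n \<ge> 1" for n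
    using that L0 L[of "n - 1"] L[of n] by (cases "n = 1") (simp_all add: vir_transl)
  then show "transl \<V> a \<in> primary \<V> \<omega> 1"
    using weight_transl[of a 0] a by (simp add: primary_def)
qed

text \<open>
  If \<open>L_(n-1) b = 0\<close>, then \<open>T L_n b = L_n T b = 0\<close>. As \<open>L_n b\<close> has weight
  \<open>- n < 0\<close>, the hypothesis on the kernel of \<open>T\<close> forces \<open>L_n b = 0\<close>. The
  induction starts at \<open>L_0 b = 0\<close>.
\<close>

lemma primary_if_transl_primary:
  assumes ker: "\<And>i. i < 0 \<Longrightarrow> {v. transl \<V> v = 0} \<inter> weight_space \<V> \<omega> i = {0}"
    and b: "b \<in> weight_space \<V> \<omega> 0" and Tb: "transl \<V> b \<in> primary \<V> \<omega> 1"
  shows "b \<in> primary \<V> \<omega> 0"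
proof -
  have "vir \<V> \<omega> (int n) b = 0" for n
  proof (induction n)
    case 0
    show ?case
      using b by (simp add: weight_space_iff)
  next
    case (Suc n)
    have "transl \<V> (vir \<V> \<omega> (int (Suc n)) b) = 0"
      using vir_transl[of "int (Suc n)" b] Tb Suc by (simp add: primary_def)
    moreover have "vir \<V> \<omega> (int (Suc n)) b \<in> weight_space \<V> \<omega> (- int (Suc n))"
      using weight_vir[OF b, of "int (Suc n)"] by simp
    ultimately show ?case
      using ker[of "- int (Suc n)"] by auto
  qed
  then have "vir \<V> \<omega> n b = 0" if "n \<ge> 1" for n
    using that by (metis nonneg_int_cases order_trans zero_le_one)
  then show ?thesis
    using b by (simp add: primary_def)
qed

lemma transl_primary_eq:
  assumes "\<And>i. i < 0 \<Longrightarrow> {v. transl \<V> v = 0} \<inter> weight_space \<V> \<omega> i = {0}"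
  shows "transl \<V> ` primary \<V> \<omega> 0 = primary \<V> \<omega> 1 \<inter> transl \<V> ` weight_space \<V> \<omega> 0"
proof
  show "transl \<V> ` primary \<V> \<omega> 0 \<subseteq> primary \<V> \<omega> 1 \<inter> transl \<V> ` weight_space \<V> \<omega> 0"
    using transl_primary unfolding primary_def[of _ _ 0] by blast
  show "primary \<V> \<omega> 1 \<inter> transl \<V> ` weight_space \<V> \<omega> 0 \<subseteq> transl \<V> ` primary \<V> \<omega> 0"
    using primary_if_transl_primary[OF assms] by blast
qed

end

section \<open>Homogeneous components\<close>

context vertex_superalgebra begin

definition component :: "int \<Rightarrow> 'v \<Rightarrow> 'v" where
  "component i v = (THE f. homogeneous_decomposition (piece \<V>) f v) i"

lemma homogeneous_decomposition_component:
  "homogeneous_decomposition (piece \<V>) (\<lambda>i. component i v) v"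
  using theI'[OF direct_sum[of v]] by (simp add: component_def)

lemma component_in_piece: "component i v \<in> piece \<V> i"
  and finite_component_support: "finite {i. component i v \<noteq> 0}"
  and sum_component: "v = (\<Sum>i | component i v \<noteq> 0. component i v)"
  using homogeneous_decomposition_component[of v] by (simp_all add: homogeneous_decomposition_def)

lemma component_eqI:
  assumes "\<And>i. f i \<in> piece \<V> i" "finite I" "\<And>i. i \<notin> I \<Longrightarrow> f i = 0" "v = (\<Sum>i\<in>I. f i)"
  shows "component i v = f i"
proof -
  have "{i. f i \<noteq> 0} \<subseteq> I"
    using assms(3) by auto
  moreover from this have "(\<Sum>i | f i \<noteq> 0. f i) = (\<Sum>i\<in>I. f i)"
    using assms(2) by (intro sum.mono_neutral_left) auto
  ultimately have "homogeneous_decomposition (piece \<V>) f v"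
    using assms finite_subset unfolding homogeneous_decomposition_def by auto
  then have "f = (\<lambda>i. component i v)"
    using direct_sum homogeneous_decomposition_component by blast
  then show ?thesis by simp
qed

lemma component_of_sum:
  assumes "finite I" "\<And>i. i \<in> I \<Longrightarrow> f i \<in> piece \<V> i"
  shows "component i (\<Sum>i\<in>I. f i) = (if i \<in> I then f i else 0)"
  using assms piece_subspace subspace_0
  by (intro component_eqI[of "\<lambda>i. if i \<in> I then f i else 0" I]) auto

text \<open>
  Graded subspaces are obtained below as eigenspaces, kernels and images of homogeneous linear maps; all of them are
  graded because such a map commutes with taking components, up to a shift.
\<close>

lemma component_of_image:
  assumes F: "module_hom (scalar \<V>) (scalar \<V>) F"
    and deg: "\<And>i a. a \<in> piece \<V> i \<Longrightarrow> F a \<in> piece \<V> (i + d)"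
  shows "component i (F v) = F (component (i - d) v)"
proof (rule component_eqI)
  let ?S = "{i. component i v \<noteq> 0}"
  show "F (component (i - d) v) \<in> piece \<V> i" for i
    using deg[OF component_in_piece, of "i - d" v] by simp
  show "finite ((\<lambda>i. i + d) ` ?S)"
    using finite_component_support by simp
  show "F (component (i - d) v) = 0" if "i \<notin> (\<lambda>i. i + d) ` ?S" for i
  proof -
    have "i - d \<notin> ?S"
      using that by (metis diff_add_cancel image_eqI)
    then show ?thesis by (simp add: module_hom.zero[OF F])
  qed
  have "F v = F (\<Sum>i\<in>?S. component i v)"
    using sum_component[of v] by simp
  then show "F v = (\<Sum>i\<in>(\<lambda>i. i + d) ` ?S. F (component (i - d) v))"
    by (simp add: module_hom.sum[OF F] sum.reindex)
qed

lemma component_diff: "component i (v - w) = component i v - component i w"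
proof -
  let ?S = "\<lambda>v. {i. component i v \<noteq> 0}"
  have *: "(\<Sum>i\<in>?S v \<union> ?S w. component i x) = x" if "x \<in> {v, w}" for x
  proof -
    have "(\<Sum>i\<in>?S v \<union> ?S w. component i x) = (\<Sum>i\<in>?S x. component i x)"
      using that finite_component_support by (intro sum.mono_neutral_right) auto
    then show ?thesis
      using sum_component[of x] by simp
  qed
  show ?thesis
    by (rule component_eqI[where I = "?S v \<union> ?S w"])
      (auto simp: finite_component_support subspace_diff[OF piece_subspace] component_in_piece
        sum_subtractf *)
qed

lemma component_scale: "component i (scalar \<V> c v) = scalar \<V> c (component i v)"
  using component_of_image[of "scalar \<V> c" 0 i v] subspace_scale[OF piece_subspace]
    module_hom_linearI[OF linear_scale_self] by simp

definition component_closed :: "'v set \<Rightarrow> bool" where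
  "component_closed W \<longleftrightarrow> (\<forall>v\<in>W. \<forall>i. component i v \<in> W)"

lemma component_closedD: "component_closed W \<Longrightarrow> v \<in> W \<Longrightarrow> component i v \<in> W"
  by (simp add: component_closed_def)

lemma graded_subspaceI:
  assumes "subspace W" "component_closed W"
  shows "graded_subspace \<V> W"
  unfolding graded_subspace_def
proof (intro conjI ballI exI)
  fix v assume "v \<in> W"
  then show "homogeneous_decomposition (\<lambda>i. piece \<V> i \<inter> W) (\<lambda>i. component i v) v"
    using homogeneous_decomposition_component[of v] component_closedD[OF assms(2)]
    by (simp add: homogeneous_decomposition_def)
qed (rule assms(1))

lemma component_closed_transl_image:
  assumes "component_closed W"
  shows "component_closed (transl \<V> ` W)"
  using component_closedD[OF assms] component_of_image[OF transl_hom transl_degree]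
  by (auto simp: component_closed_def)

end

context conformal_vertex_superalgebra begin

lemma component_vir: "component i (vir \<V> \<omega> n v) = vir \<V> \<omega> n (component (i + 2 * n) v)"
proof -
  have "vir \<V> \<omega> n a \<in> piece \<V> (i + (- 2 * n))" if "a \<in> piece \<V> i" for i a
    using mode_degree[OF conformal_degree that, of "n + 1"] by (simp add: vir_def algebra_simps)
  from component_of_image[of "vir \<V> \<omega> n" "- 2 * n" i v, OF _ this]
  show ?thesis
    using mode_right_hom[of \<omega> "n + 1"] by (simp add: vir_def)
qed

lemma component_closed_weight_space: "component_closed (weight_space \<V> \<omega> p)"
  using component_vir[of _ 0, symmetric] by (simp add: component_closed_def weight_space_iff component_scale)

lemma component_closed_primary: "component_closed (primary \<V> \<omega> p)"
  unfolding component_closed_def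
proof (intro ballI allI)
  fix v i assume v: "v \<in> primary \<V> \<omega> p"
  have "component j 0 = 0" for j
    using component_of_sum[of "{}"] by simp
  then have "vir \<V> \<omega> n (component i v) = 0" if "n \<ge> 1" for n
    using component_vir[of "i - 2 * n" n v] that v by (simp add: primary_def)
  then show "component i v \<in> primary \<V> \<omega> p"
    using v component_closedD[OF component_closed_weight_space] by (simp add: primary_def)
qed

end

section \<open>Lie superalgebras from the zeroth product\<close>

context vertex_superalgebra begin

lemma cls_eq: "a \<in> W \<Longrightarrow> cls W U a = {b \<in> W. a - b \<in> U}"
  by (auto simp: cls_def mod_rel_def)

lemma cls_eq_iff:
  assumes "subspace U" "a \<in> W" "b \<in> W"
  shows "cls W U a = cls W U b \<longleftrightarrow> a - b \<in> U"
proof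
  assume "cls W U a = cls W U b"
  then have "b \<in> cls W U a"
    using assms by (simp add: cls_eq subspace_0)
  then show "a - b \<in> U"
    using assms by (simp add: cls_eq)
next
  assume ab: "a - b \<in> U"
  have "a - x \<in> U \<longleftrightarrow> b - x \<in> U" for x
    using subspace_diff[OF assms(1) _ ab, of "a - x"] subspace_add[OF assms(1) _ ab, of "b - x"] by auto
  then show "cls W U a = cls W U b"
    using assms by (simp add: cls_eq)
qed

text \<open>
  The operations on cosets are unions over representatives; this evaluates such a union when its members do not depend
  on the representative.
\<close>

lemma UN_cls:
  assumes "subspace U" "a \<in> W" "\<And>a'. a' \<in> W \<Longrightarrow> a - a' \<in> U \<Longrightarrow> G a' = G a"
  shows "(\<Union>a'\<in>cls W U a. G a') = G a"
proof -
  have "a \<in> cls W U a"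
    using assms(1,2) by (simp add: cls_eq subspace_0)
  moreover have "G a' = G a" if "a' \<in> cls W U a" for a'
    using that assms(2) by (intro assms(3)) (simp_all add: cls_eq)
  ultimately show ?thesis by blast
qed

lemma natural_map_cls:
  assumes "subspace U" "subspace U'" "U \<subseteq> U'" "W \<subseteq> W'" "a \<in> W"
  shows "natural_map W' U' (cls W U a) = cls W' U' a"
  unfolding natural_map_def
proof (rule UN_cls[OF assms(1,5)])
  fix a' assume a': "a' \<in> W" "a - a' \<in> U"
  have "- (a - a') \<in> U"
    using a'(2) by (rule subspace_neg[OF assms(1)])
  then show "cls W' U' a' = cls W' U' a"
    using assms a' by (subst cls_eq_iff[OF assms(2)]) auto
qed

end

lemma complex_ring_simps [simp]:
  "carrier complex_ring = UNIV" "x \<oplus>\<^bsub>complex_ring\<^esub> y = x + y" "x \<otimes>\<^bsub>complex_ring\<^esub> y = x * y"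
  "\<one>\<^bsub>complex_ring\<^esub> = 1"
  by (simp_all add: ring_of_type_algebra_def)

text \<open>
  The Jacobi identity for \<open>a_(0) b\<close> holds already in \<open>V\<close>, so a quotient \<open>W / U\<close>
  of graded subspaces is a graded Lie superalgebra as soon as \<open>U\<close> is an ideal of \<open>W\<close> for the
  zeroth product and absorbs the failure of skew-symmetry. Treating \<open>W\<close> and \<open>U\<close> as
  parameters covers the Lie algebras of weight-one states and of primary states at once.
\<close>

locale zero_mode_quotient = vertex_superalgebra \<V>
  for \<V> :: "'v::ab_group_add vertex_data" and W U :: "'v set" +
  assumes W: "subspace W" "component_closed W"
    and U: "subspace U" "component_closed U" "U \<subseteq> W"
    and zero_mode_closed: "\<And>a b. a \<in> W \<Longrightarrow> b \<in> W \<Longrightarrow> nmode \<V> a 0 b \<in> W"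
    and zero_mode_ideal_left: "\<And>u a. u \<in> U \<Longrightarrow> a \<in> W \<Longrightarrow> nmode \<V> u 0 a \<in> U"
    and zero_mode_ideal_right: "\<And>u a. u \<in> U \<Longrightarrow> a \<in> W \<Longrightarrow> nmode \<V> a 0 u \<in> U"
    and zero_mode_skew: "\<And>i j a b. a \<in> W \<inter> piece \<V> i \<Longrightarrow> b \<in> W \<inter> piece \<V> j \<Longrightarrow>
      nmode \<V> a 0 b + scalar \<V> (koszul_sign i j) (nmode \<V> b 0 a) \<in> U"
begin

abbreviation "L \<equiv> borcherds \<V> W U"
abbreviation "q \<equiv> cls W U"

lemma q_eq_iff: "a \<in> W \<Longrightarrow> b \<in> W \<Longrightarrow> q a = q b \<longleftrightarrow> a - b \<in> U"
  by (rule cls_eq_iff[OF U(1)])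

lemmas W_intros [simp, intro] =
  subspace_0[OF W(1)] subspace_add[OF W(1)] subspace_diff[OF W(1)] subspace_neg[OF W(1)]
  subspace_scale[OF W(1)] zero_mode_closed

lemma carrier_L: "carrier L = q ` W"
  by (auto simp: borcherds_def quotient_def cls_def)

lemma zero_L: "\<zero>\<^bsub>L\<^esub> = q 0"
  by (simp add: borcherds_def)

lemma lpiece_L: "lpiece L i = q ` (W \<inter> piece \<V> (i + 2))"
  by (simp add: borcherds_def)

lemma add_L:
  assumes "a \<in> W" "b \<in> W"
  shows "q a \<oplus>\<^bsub>L\<^esub> q b = q (a + b)"
proof -
  have "(\<Union>b'\<in>q b. q (a' + b')) = q (a + b)" if a': "a' \<in> W" "a - a' \<in> U" for a'
  proof (rule trans[OF UN_cls[OF U(1) assms(2), of "\<lambda>b'. q (a' + b')"]])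
    fix b' assume b': "b' \<in> W" "b - b' \<in> U"
    have "- (b - b') \<in> U"
      using b'(2) by (rule subspace_neg[OF U(1)])
    then show "q (a' + b') = q (a' + b)"
      using a' b' assms by (subst q_eq_iff) auto
  next
    have "- (a - a') \<in> U"
      using a'(2) by (rule subspace_neg[OF U(1)])
    then show "q (a' + b) = q (a + b)"
      using a' assms by (subst q_eq_iff) auto
  qed
  moreover have "a - a \<in> U"
    by (simp add: subspace_0[OF U(1)])
  ultimately have "(\<Union>a'\<in>q a. \<Union>b'\<in>q b. q (a' + b')) = q (a + b)"
    using UN_cls[OF U(1) assms(1), of "\<lambda>a'. \<Union>b'\<in>q b. q (a' + b')"] assms(1) by simp
  then show ?thesis
    by (simp add: borcherds_def)
qed

lemma smult_L:
  assumes "a \<in> W"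
  shows "c \<odot>\<^bsub>L\<^esub> q a = q (scalar \<V> c a)"
proof -
  have "(\<Union>a'\<in>q a. q (scalar \<V> c a')) = q (scalar \<V> c a)"
  proof (rule UN_cls[OF U(1) assms])
    fix a' assume a': "a' \<in> W" "a - a' \<in> U"
    then have "scalar \<V> c (- (a - a')) \<in> U"
      by (intro subspace_scale[OF U(1)] subspace_neg[OF U(1)])
    then show "q (scalar \<V> c a') = q (scalar \<V> c a)"
      using a' assms by (subst q_eq_iff) (auto simp: scale_right_diff_distrib)
  qed
  then show ?thesis
    by (simp add: borcherds_def)
qed

lemma bracket_L:
  assumes "a \<in> W" "b \<in> W"
  shows "bracket L (q a) (q b) = q (nmode \<V> a 0 b)"
proof -
  have "(\<Union>b'\<in>q b. q (nmode \<V> a' 0 b')) = q (nmode \<V> a 0 b)" if a': "a' \<in> W" "a - a' \<in> U" for a'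
  proof (rule trans[OF UN_cls[OF U(1) assms(2), of "\<lambda>b'. q (nmode \<V> a' 0 b')"]])
    fix b' assume b': "b' \<in> W" "b - b' \<in> U"
    then have "nmode \<V> a' 0 (- (b - b')) \<in> U"
      by (intro zero_mode_ideal_right subspace_neg[OF U(1)] a')
    then show "q (nmode \<V> a' 0 b') = q (nmode \<V> a' 0 b)"
      using a' b' assms by (subst q_eq_iff) auto
  next
    have "nmode \<V> (- (a - a')) 0 b \<in> U"
      by (intro zero_mode_ideal_left subspace_neg[OF U(1)] a' assms)
    then show "q (nmode \<V> a' 0 b) = q (nmode \<V> a 0 b)"
      using a' assms by (subst q_eq_iff) auto
  qed
  moreover have "a - a \<in> U"
    by (simp add: subspace_0[OF U(1)])
  ultimately have "(\<Union>a'\<in>q a. \<Union>b'\<in>q b. q (nmode \<V> a' 0 b')) = q (nmode \<V> a 0 b)"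
    using UN_cls[OF U(1) assms(1), of "\<lambda>a'. \<Union>b'\<in>q b. q (nmode \<V> a' 0 b')"] assms(1) by simp
  then show ?thesis
    by (simp add: borcherds_def)
qed

lemmas L_simps = add_L smult_L bracket_L

lemma module_L: "Module.module complex_ring L"
proof (rule moduleI)
  show "cring complex_ring"
    by (rule cring_from_type_algebra)
  show "abelian_group L"
  proof (rule abelian_groupI)
    fix x assume "x \<in> carrier L"
    then obtain a where a: "x = q a" "a \<in> W"
      by (auto simp: carrier_L)
    then have "q (- a) \<oplus>\<^bsub>L\<^esub> x = \<zero>\<^bsub>L\<^esub>"
      by (simp add: L_simps zero_L)
    moreover have "q (- a) \<in> carrier L"
      using a(2) by (simp add: carrier_L)
    ultimately show "\<exists>y\<in>carrier L. y \<oplus>\<^bsub>L\<^esub> x = \<zero>\<^bsub>L\<^esub>" ..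
  qed (auto simp: carrier_L zero_L L_simps add_ac)
qed (auto simp: carrier_L L_simps scale_left_distrib scale_right_distrib)

sublocale L: Module.module complex_ring L
  by (rule module_L)

lemma submodule_image:
  assumes "subspace H" "H \<subseteq> W"
  shows "submodule (q ` H) complex_ring L"
proof (rule L.submoduleI)
  show "q ` H \<subseteq> carrier L"
    using assms(2) by (auto simp: carrier_L)
  show "\<zero>\<^bsub>L\<^esub> \<in> q ` H"
    using subspace_0[OF assms(1)] by (simp add: zero_L)
  show "x \<oplus>\<^bsub>L\<^esub> y \<in> q ` H" if "x \<in> q ` H" "y \<in> q ` H" for x y
    using that assms(2) subspace_add[OF assms(1)] by (auto simp: L_simps subset_eq)
  show smult: "c \<odot>\<^bsub>L\<^esub> x \<in> q ` H" if "x \<in> q ` H" for c x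
    using that assms(2) subspace_scale[OF assms(1)] by (auto simp: L_simps subset_eq)
  show "\<ominus>\<^bsub>L\<^esub> x \<in> q ` H" if x: "x \<in> q ` H" for x
  proof -
    obtain a where a: "x = q a" "a \<in> H"
      using x by blast
    then have "q (- a) \<oplus>\<^bsub>L\<^esub> x = \<zero>\<^bsub>L\<^esub>" and "x \<in> carrier L" and "q (- a) \<in> carrier L"
      using assms(2) by (auto simp: L_simps zero_L carrier_L subset_eq)
    then have "\<ominus>\<^bsub>L\<^esub> x = q (- a)"
      by (rule L.minus_equality)
    then show ?thesis
      using subspace_neg[OF assms(1) a(2)] by simp
  qed
qed

lemma finsum_q:
  assumes "finite I" "\<And>i. i \<in> I \<Longrightarrow> g i \<in> W"
  shows "finsum L (\<lambda>i. q (g i)) I = q (\<Sum>i\<in>I. g i)"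
  using assms
proof (induction I)
  case empty
  show ?case by (simp add: zero_L)
next
  case (insert i I)
  have "(\<Sum>i\<in>I. g i) \<in> W"
    using insert.prems by (intro subspace_sum[OF W(1)]) simp
  then show ?case
    using insert by (subst L.finsum_insert) (auto simp: carrier_L L_simps)
qed

text \<open>
  A class is decomposed through the components of a representative. A nonzero component may have zero class, so the
  sum over the nonzero classes recovers the representative only modulo \<open>U\<close>. The subspace \<open>H\<close>
  is there to obtain the grading of the Lie subalgebras of \<open>W / U\<close> along with that of
  \<open>W / U\<close>.
\<close>

lemma lie_decomposition_image:
  assumes "H \<subseteq> W" "component_closed H" "w \<in> H"
  shows "lie_decomposition L (\<lambda>i. lpiece L i \<inter> q ` H) (\<lambda>i. q (component (i + 2) w)) (q w)"
  unfolding lie_decomposition_def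
proof (intro conjI allI)
  let ?c = "\<lambda>i. component (i + 2) w"
  have cW: "?c i \<in> W" for i
    using component_closedD[OF W(2)] assms by blast
  show "q (?c i) \<in> lpiece L i \<inter> q ` H" for i
    using cW component_in_piece component_closedD[OF assms(2,3)] by (auto simp: lpiece_L)
  let ?S = "{i. q (?c i) \<noteq> \<zero>\<^bsub>L\<^esub>}" and ?I = "{i. ?c i \<noteq> 0}"
  have I_eq: "?I = (\<lambda>i. i - 2) ` {i. component i w \<noteq> 0}"
    by force
  have fin: "finite ?I"
    unfolding I_eq using finite_component_support by blast
  have sub: "?S \<subseteq> ?I"
    by (auto simp: zero_L)
  then show finS: "finite ?S"
    using fin finite_subset by blast
  have "w = (\<Sum>i\<in>?I. ?c i)"
    unfolding I_eq using sum_component[of w] by (simp add: sum.reindex inj_on_def)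
  also have "\<dots> = (\<Sum>i\<in>?S. ?c i) + (\<Sum>i\<in>?I - ?S. ?c i)"
    using sum.subset_diff[OF sub fin, of ?c] by (simp add: add.commute)
  finally have "w - (\<Sum>i\<in>?S. ?c i) = (\<Sum>i\<in>?I - ?S. ?c i)"
    by (simp add: algebra_simps)
  moreover have "(\<Sum>i\<in>?I - ?S. ?c i) \<in> U"
    using cW q_eq_iff[of "?c i" 0 for i] by (intro subspace_sum[OF U(1)]) (auto simp: zero_L)
  ultimately have "q w = q (\<Sum>i\<in>?S. ?c i)"
    using assms cW by (subst q_eq_iff) (auto intro: subspace_sum[OF W(1)])
  then show "q w = finsum L (\<lambda>i. q (?c i)) ?S"
    using finsum_q[OF finS cW] by simp
qed

text \<open>
  Two decompositions lift to elements of \<open>W\<close> that differ by an element of \<open>U\<close>; since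
  \<open>U\<close> is graded, they then differ by elements of \<open>U\<close> in every degree.
\<close>

lemma lie_decomposition_unique:
  assumes f: "lie_decomposition L (lpiece L) f (q w)" and w: "w \<in> W"
  shows "f i = q (component (i + 2) w)"
proof -
  let ?S = "{i. f i \<noteq> \<zero>\<^bsub>L\<^esub>}"
  have "\<forall>i. \<exists>a. a \<in> W \<inter> piece \<V> (i + 2) \<and> f i = q a"
    using f by (auto simp: lie_decomposition_def lpiece_L)
  then obtain g where g: "g i \<in> W" "g i \<in> piece \<V> (i + 2)" "f i = q (g i)" for i
    by (metis IntE)
  have fin: "finite ?S" and sum: "q w = finsum L f ?S"
    using f by (simp_all add: lie_decomposition_def)
  have "(\<lambda>i. q (g i)) = f"
    by (rule ext) (rule g(3)[symmetric])
  with finsum_q[of ?S g, OF fin g(1)] have "q w = q (\<Sum>i\<in>?S. g i)"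
    unfolding sum by (simp only:)
  moreover have "(\<Sum>i\<in>?S. g i) \<in> W"
    using g(1) by (rule subspace_sum[OF W(1)])
  ultimately have "w - (\<Sum>i\<in>?S. g i) \<in> U"
    using w q_eq_iff by blast
  then have "component (i + 2) (w - (\<Sum>i\<in>?S. g i)) \<in> U"
    by (rule component_closedD[OF U(2)])
  moreover have "(\<Sum>i\<in>?S. g i) = (\<Sum>j\<in>(\<lambda>i. i + 2) ` ?S. g (j - 2))"
    by (simp add: sum.reindex)
  moreover have "component (i + 2) (\<Sum>j\<in>(\<lambda>i. i + 2) ` ?S. g (j - 2)) = (if i \<in> ?S then g i else 0)"
    using fin g(2) by (subst component_of_sum) auto
  ultimately have "component (i + 2) w - (if i \<in> ?S then g i else 0) \<in> U"
    by (simp only: component_diff)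
  then have "q (component (i + 2) w) = q (if i \<in> ?S then g i else 0)"
    using g(1) component_closedD[OF W(2) w] by (subst q_eq_iff) auto
  then show ?thesis
    using g(3)[of i] by (auto simp: zero_L split: if_splits)
qed

theorem lie_superalgebra_L: "lie_superalgebra L"
proof (intro lie_superalgebra.intro module_L lie_superalgebra_axioms.intro)
  show "submodule (lpiece L i) complex_ring L" for i
    unfolding lpiece_L
    by (rule submodule_image) (auto intro: subspace_inter W(1) piece_subspace)
  show "\<exists>!f. lie_decomposition L (lpiece L) f x" if x: "x \<in> carrier L" for x
  proof -
    obtain w where w: "x = q w" "w \<in> W"
      using x by (auto simp: carrier_L)
    have "lie_decomposition L (lpiece L) (\<lambda>i. q (component (i + 2) w)) x"
      using lie_decomposition_image[OF order_refl W(2) w(2)] w(1)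
      by (auto simp: lie_decomposition_def)
    then show ?thesis
      using lie_decomposition_unique[OF _ w(2)] w(1) by (intro ex1I ext) auto
  qed
  show "bracket L x y = (- koszul_sign i j) \<odot>\<^bsub>L\<^esub> bracket L y x"
    if xy: "x \<in> lpiece L i" "y \<in> lpiece L j" for i j x y
  proof -
    obtain a b where ab: "x = q a" "a \<in> W \<inter> piece \<V> (i + 2)" "y = q b" "b \<in> W \<inter> piece \<V> (j + 2)"
      using xy by (auto simp: lpiece_L)
    have "nmode \<V> a 0 b + scalar \<V> (koszul_sign i j) (nmode \<V> b 0 a) \<in> U"
      using zero_mode_skew[OF ab(2,4)] by (simp add: koszul_sign_def)
    then show ?thesis
      using ab by (simp add: L_simps q_eq_iff)
  qed
  show "bracket L x (bracket L y z)
      = bracket L (bracket L x y) z \<oplus>\<^bsub>L\<^esub> koszul_sign i j \<odot>\<^bsub>L\<^esub> bracket L y (bracket L x z)"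
    if xyz: "x \<in> lpiece L i" "y \<in> lpiece L j" "z \<in> carrier L" for i j x y z
  proof -
    obtain a b c where abc: "x = q a" "a \<in> W" "a \<in> piece \<V> (i + 2)"
        "y = q b" "b \<in> W" "b \<in> piece \<V> (j + 2)" "z = q c" "c \<in> W"
      using xyz by (auto simp: lpiece_L carrier_L)
    show ?thesis
      using abc zero_mode_commutator[OF abc(3,6), of c] by (simp add: L_simps koszul_sign_def)
  qed
  show "bracket L x y \<in> lpiece L (i + j)" if xy: "x \<in> lpiece L i" "y \<in> lpiece L j" for i j x y
  proof -
    obtain a b where ab: "x = q a" "a \<in> W" "a \<in> piece \<V> (i + 2)" "y = q b" "b \<in> W" "b \<in> piece \<V> (j + 2)"
      using xy by (auto simp: lpiece_L)
    then have "nmode \<V> a 0 b \<in> piece \<V> (i + j + 2)"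
      using mode_degree[OF ab(3,6), of 0] by (simp add: algebra_simps)
    then show ?thesis
      using ab by (auto simp: L_simps lpiece_L)
  qed
qed (auto simp: carrier_L L_simps scale_right_distrib)

lemma lie_subalgebra_image:
  assumes H: "subspace H" "component_closed H" "H \<subseteq> W"
    and closed: "\<And>a b. a \<in> H \<Longrightarrow> b \<in> H \<Longrightarrow> nmode \<V> a 0 b \<in> H"
  shows "lie_subalgebra (q ` H) L"
  unfolding lie_subalgebra_def
proof (intro conjI ballI lie_superalgebra_L submodule_image H)
  fix x assume "x \<in> q ` H"
  then show "\<exists>f. lie_decomposition L (\<lambda>i. lpiece L i \<inter> q ` H) f x"
    using lie_decomposition_image[OF H(3,2)] by blast
next
  fix x y assume "x \<in> q ` H" "y \<in> q ` H"
  then show "bracket L x y \<in> q ` H"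
    using H(3) closed by (auto simp: subset_eq L_simps)
qed

end

section \<open>The Lie algebras of weight-one and of primary states\<close>

context vertex_superalgebra begin

lemma subspace_transl_image: "subspace W \<Longrightarrow> subspace (transl \<V> ` W)"
  by (rule module_hom.subspace_image[OF transl_hom])

end

context conformal_vertex_superalgebra begin

lemma zero_mode_transl_left: "nmode \<V> (transl \<V> a) 0 b = 0"
  by (simp add: mode_transl)

lemma zero_mode_transl_right: "nmode \<V> a 0 (transl \<V> b) = transl \<V> (nmode \<V> a 0 b)"
  using translation_covariance[of a 0 b] by simp

lemma zero_mode_quotient_weight:
  "zero_mode_quotient \<V> (weight_space \<V> \<omega> 1) (transl \<V> ` weight_space \<V> \<omega> 0)"
proof unfold_locales
  show "nmode \<V> a 0 b \<in> weight_space \<V> \<omega> 1"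
    if "a \<in> weight_space \<V> \<omega> 1" "b \<in> weight_space \<V> \<omega> 1" for a b
    using weight_mode[OF that, of 0] by simp
  show "transl \<V> ` weight_space \<V> \<omega> 0 \<subseteq> weight_space \<V> \<omega> 1"
    using weight_transl[of _ 0] by auto
  show "nmode \<V> u 0 a \<in> transl \<V> ` weight_space \<V> \<omega> 0"
    if "u \<in> transl \<V> ` weight_space \<V> \<omega> 0" "a \<in> weight_space \<V> \<omega> 1" for u a
    using that subspace_0[OF subspace_transl_image[OF subspace_weight_space]]
    by (auto simp: zero_mode_transl_left)
  show "nmode \<V> a 0 u \<in> transl \<V> ` weight_space \<V> \<omega> 0"
    if u: "u \<in> transl \<V> ` weight_space \<V> \<omega> 0" and a: "a \<in> weight_space \<V> \<omega> 1" for u a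
    using u weight_mode[OF a, of _ 0 0] by (auto simp: zero_mode_transl_right)
  show "nmode \<V> a 0 b + scalar \<V> (koszul_sign i j) (nmode \<V> b 0 a) \<in> transl \<V> ` weight_space \<V> \<omega> 0"
    if "a \<in> weight_space \<V> \<omega> 1 \<inter> piece \<V> i" "b \<in> weight_space \<V> \<omega> 1 \<inter> piece \<V> j" for i j a b
    using that skew_symmetry_weight_one by blast
qed (rule subspace_weight_space component_closed_weight_space subspace_transl_image
    component_closed_transl_image)+

text \<open>
  For \<open>a, b \<in> P_1\<close> the skew-symmetry defect is a priori only in \<open>T(V_0^\<omega>)\<close>. It is
  itself primary, so the hypothesis brings it back into \<open>T(P_0)\<close>.
\<close>

lemma zero_mode_quotient_primary:
  assumes eq: "transl \<V> ` primary \<V> \<omega> 0 = primary \<V> \<omega> 1 \<inter> transl \<V> ` weight_space \<V> \<omega> 0"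
  shows "zero_mode_quotient \<V> (primary \<V> \<omega> 1) (transl \<V> ` primary \<V> \<omega> 0)"
proof unfold_locales
  show "nmode \<V> a 0 b \<in> primary \<V> \<omega> 1"
    if "a \<in> primary \<V> \<omega> 1" "b \<in> primary \<V> \<omega> 1" for a b
    using that by (rule primary_zero_mode)
  show "nmode \<V> u 0 a \<in> transl \<V> ` primary \<V> \<omega> 0"
    if "u \<in> transl \<V> ` primary \<V> \<omega> 0" "a \<in> primary \<V> \<omega> 1" for u a
    using that subspace_0[OF subspace_transl_image[OF subspace_primary]]
    by (auto simp: zero_mode_transl_left)
  show "nmode \<V> a 0 u \<in> transl \<V> ` primary \<V> \<omega> 0"
    if u: "u \<in> transl \<V> ` primary \<V> \<omega> 0" and a: "a \<in> primary \<V> \<omega> 1" for u a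
    using u primary_zero_mode[OF a] by (auto simp: zero_mode_transl_right)
  show "nmode \<V> a 0 b + scalar \<V> (koszul_sign i j) (nmode \<V> b 0 a) \<in> transl \<V> ` primary \<V> \<omega> 0"
    if a: "a \<in> primary \<V> \<omega> 1 \<inter> piece \<V> i" and b: "b \<in> primary \<V> \<omega> 1 \<inter> piece \<V> j" for i j a b
  proof -
    have "nmode \<V> a 0 b + scalar \<V> (koszul_sign i j) (nmode \<V> b 0 a) \<in> transl \<V> ` weight_space \<V> \<omega> 0"
      using a b by (intro skew_symmetry_weight_one) (auto simp: primary_def)
    moreover have "nmode \<V> a 0 b + scalar \<V> (koszul_sign i j) (nmode \<V> b 0 a) \<in> primary \<V> \<omega> 1"
      using a b by (intro subspace_add[OF subspace_primary] subspace_scale[OF subspace_primary] primary_zero_mode) auto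
    ultimately show ?thesis
      unfolding eq by blast
  qed
qed (rule subspace_primary component_closed_primary subspace_transl_image
    component_closed_transl_image transl_primary)+

text \<open>
  The set of values \<open>a'_(0) b\<close> over the class of \<open>a\<close> modulo \<open>T(V)\<close> is a
  singleton because \<open>(T c)_(0) = 0\<close>.
\<close>

lemma P_check_0_action_cls:
  assumes "a \<in> primary \<V> \<omega> 1"
  shows "P_check_0_action \<V> (cls (primary \<V> \<omega> 1) (transl \<V> ` primary \<V> \<omega> 0) a) b = nmode \<V> a 0 b"
proof -
  let ?A = "cls UNIV (range (transl \<V>)) a"
  have range: "subspace (range (transl \<V>))"
    by (rule subspace_transl_image) simp
  have "natural_map UNIV (range (transl \<V>)) (cls (primary \<V> \<omega> 1) (transl \<V> ` primary \<V> \<omega> 0) a) = ?A"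
    using assms by (intro natural_map_cls subspace_transl_image subspace_primary range) auto
  moreover have "(\<lambda>a. nmode \<V> a 0 b) ` ?A = {nmode \<V> a 0 b}"
  proof -
    have "(\<lambda>a. nmode \<V> a 0 b) ` ?A = (\<lambda>_. nmode \<V> a 0 b) ` ?A"
    proof (rule image_cong[OF refl])
      fix a' assume "a' \<in> ?A"
      then obtain c where "a - a' = transl \<V> c"
        by (auto simp: cls_eq)
      then have "nmode \<V> (a - a') 0 b = 0"
        by (simp only: zero_mode_transl_left)
      then show "nmode \<V> a' 0 b = nmode \<V> a 0 b"
        by simp
    qed
    moreover have "a \<in> ?A"
      using subspace_0[OF range] by (simp add: cls_eq)
    ultimately show ?thesis
      by (simp only: image_constant)
  qed
  ultimately show ?thesis
    by (simp add: P_check_0_action_def V_check_action_def)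
qed

end

text \<open>
  Both quotients are instances of \<open>zero_mode_quotient\<close>, and the image of the inclusion is the set of
  classes of the subspace \<open>P_1\<close> of \<open>V_1^\<omega>\<close>. Injectivity is the identity
  \<open>T(P_0) = P_1 \<inter> T(V_0^\<omega>)\<close>.
\<close>

theorem theorem3:
  fixes \<V> :: "'v::ab_group_add vertex_data" and \<omega> :: 'v
  assumes "conformal_vertex_superalgebra \<V> \<omega>"
    and "\<And>i::int. i < 0 \<Longrightarrow> {v. transl \<V> v = 0} \<inter> weight_space \<V> \<omega> i = {0}"
  shows "(transl \<V> ` primary \<V> \<omega> 0 \<subseteq> primary \<V> \<omega> 1
      \<and> (\<forall>a\<in>primary \<V> \<omega> 1.
            P_check_0_incl \<V> \<omega> (cls (primary \<V> \<omega> 1) (transl \<V> ` primary \<V> \<omega> 0) a)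
              = cls (weight_space \<V> \<omega> 1) (transl \<V> ` weight_space \<V> \<omega> 0) a)
      \<and> P_check_0_incl \<V> \<omega> \<in> lie_hom (P_check_0 \<V> \<omega>) (V_check_0 \<V> \<omega>)
      \<and> inj_on (P_check_0_incl \<V> \<omega>) (carrier (P_check_0 \<V> \<omega>))
      \<and> lie_subalgebra (P_check_0_incl \<V> \<omega> ` carrier (P_check_0 \<V> \<omega>)) (V_check_0 \<V> \<omega>))
    \<and> (\<forall>i::int.
        (\<forall>a\<in>primary \<V> \<omega> 1. \<forall>b\<in>primary \<V> \<omega> i.
            P_check_0_action \<V> (cls (primary \<V> \<omega> 1) (transl \<V> ` primary \<V> \<omega> 0) a) b
              = nmode \<V> a 0 b)
      \<and> (\<forall>x\<in>carrier (P_check_0 \<V> \<omega>). \<forall>b\<in>primary \<V> \<omega> i.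
            P_check_0_action \<V> x b \<in> primary \<V> \<omega> i)
      \<and> lie_subrepresentation \<V> (P_check_0 \<V> \<omega>) (P_check_0_action \<V>)
          (primary \<V> \<omega> i) (weight_space \<V> \<omega> i))"
proof -
  interpret conformal_vertex_superalgebra \<V> \<omega> by (rule assms(1))
  let ?P1 = "primary \<V> \<omega> 1" and ?TP = "transl \<V> ` primary \<V> \<omega> 0"
  let ?W1 = "weight_space \<V> \<omega> 1" and ?TW = "transl \<V> ` weight_space \<V> \<omega> 0"
  have TP: "?TP = ?P1 \<inter> ?TW"
    by (rule transl_primary_eq[OF assms(2)])
  interpret W: zero_mode_quotient \<V> ?W1 ?TW
    by (rule zero_mode_quotient_weight)
  interpret P: zero_mode_quotient \<V> ?P1 ?TP
    by (rule zero_mode_quotient_primary[OF TP])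
  have P1_W1: "primary \<V> \<omega> i \<subseteq> weight_space \<V> \<omega> i" for i
    by (auto simp: primary_def)
  note P1D = subsetD[OF P1_W1]
  have incl: "P_check_0_incl \<V> \<omega> (P.q a) = W.q a" if "a \<in> ?P1" for a
    unfolding P_check_0_incl_def using that TP P1_W1
    by (intro natural_map_cls subspace_transl_image subspace_primary subspace_weight_space) auto
  note unfold = P_check_0_def V_check_0_def
  have hom: "P_check_0_incl \<V> \<omega> \<in> lie_hom (P_check_0 \<V> \<omega>) (V_check_0 \<V> \<omega>)"
    unfolding lie_hom_def unfold
    by (auto simp: P.carrier_L W.carrier_L P.L_simps W.L_simps incl P1D P.lpiece_L W.lpiece_L)
  have inj: "inj_on (P_check_0_incl \<V> \<omega>) (carrier (P_check_0 \<V> \<omega>))"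
    unfolding unfold
  proof (rule inj_onI)
    fix x y assume "x \<in> carrier P.L" "y \<in> carrier P.L"
    then obtain a b where ab: "x = P.q a" "a \<in> ?P1" "y = P.q b" "b \<in> ?P1"
      by (auto simp: P.carrier_L)
    assume "P_check_0_incl \<V> \<omega> x = P_check_0_incl \<V> \<omega> y"
    then have "a - b \<in> ?TW"
      using ab by (simp add: incl W.q_eq_iff P1D)
    moreover have "a - b \<in> ?P1"
      using ab by (intro subspace_diff[OF subspace_primary])
    ultimately have "a - b \<in> ?TP"
      using TP by blast
    then show "x = y"
      using ab by (simp add: P.q_eq_iff)
  qed
  have "P_check_0_incl \<V> \<omega> ` carrier (P_check_0 \<V> \<omega>) = W.q ` ?P1"
    by (auto simp: unfold P.carrier_L incl image_image)
  then have sub: "lie_subalgebra (P_check_0_incl \<V> \<omega> ` carrier (P_check_0 \<V> \<omega>)) (V_check_0 \<V> \<omega>)"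
    using W.lie_subalgebra_image[OF subspace_primary component_closed_primary P1_W1 primary_zero_mode]
    by (simp add: unfold)
  have act: "P_check_0_action \<V> (P.q a) b = nmode \<V> a 0 b" if "a \<in> ?P1" for a b
    using that by (rule P_check_0_action_cls)
  have rep: "lie_representation \<V> (P_check_0 \<V> \<omega>) (P_check_0_action \<V>) (weight_space \<V> \<omega> i)" for i
    unfolding lie_representation_def unfold
  proof (intro conjI P.lie_superalgebra_L graded_subspaceI subspace_weight_space
      component_closed_weight_space ballI allI)
    fix x y v assume x: "x \<in> carrier P.L" and v: "v \<in> weight_space \<V> \<omega> i"
    then show "P_check_0_action \<V> x v \<in> weight_space \<V> \<omega> i"
      using weight_mode[of _ 1 v i 0] by (auto simp: P.carrier_L act P1D)
  next
    fix j k x v assume x: "x \<in> lpiece P.L j" and v: "v \<in> piece \<V> k \<inter> weight_space \<V> \<omega> i"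
    then show "P_check_0_action \<V> x v \<in> piece \<V> (j + k)"
      using mode_degree[of _ "j + 2" v k 0] by (auto simp: P.lpiece_L act algebra_simps)
  next
    fix j k x y v
    assume x: "x \<in> lpiece P.L j" and y: "y \<in> lpiece P.L k" and v: "v \<in> weight_space \<V> \<omega> i"
    obtain a b where ab: "x = P.q a" "a \<in> ?P1" "a \<in> piece \<V> (j + 2)"
        "y = P.q b" "b \<in> ?P1" "b \<in> piece \<V> (k + 2)"
      using x y by (auto simp: P.lpiece_L)
    have sign: "koszul_sign (j + 2) (k + 2) = koszul_sign j k"
      by (simp add: koszul_sign_def)
    show "P_check_0_action \<V> (bracket P.L x y) v
        = P_check_0_action \<V> x (P_check_0_action \<V> y v)
          - scalar \<V> (koszul_sign j k) (P_check_0_action \<V> y (P_check_0_action \<V> x v))"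
      using ab zero_mode_commutator[OF ab(3,6), of v]
      by (simp add: P.L_simps act sign)
  qed (auto simp: P.carrier_L P.L_simps act)
  have closed: "P_check_0_action \<V> x b \<in> primary \<V> \<omega> i"
    if "x \<in> carrier (P_check_0 \<V> \<omega>)" "b \<in> primary \<V> \<omega> i" for x b i
    using that primary_zero_mode by (auto simp: P_check_0_def P.carrier_L act)
  have "lie_subrepresentation \<V> (P_check_0 \<V> \<omega>) (P_check_0_action \<V>)
      (primary \<V> \<omega> i) (weight_space \<V> \<omega> i)" for i
    unfolding lie_subrepresentation_def
    by (intro conjI ballI rep closed P1_W1 graded_subspaceI subspace_primary component_closed_primary)
  then show ?thesis
    by (intro conjI allI ballI transl_primary incl hom inj sub act closed)
qed

end
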